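(* Consider a quasi-static process along a Hamiltonian trajectory $u\mapsto H(u)$, $u\in[0,1]$, described by a family of generalised Gibbs ensemble (GGE) equilibrium states $\omega_{\mathrm{GGE}}(u)$. Then the entropy $S(\omega_{\mathrm{GGE}}(u))$ is preserved in such a quasi-static process, provided that the Lagrange multipliers $\lambda_j^{(m)}$, as determined by $$\mathrm{tr}\big(\omega^{(m)}_{\mathrm{GGE}}Q_i^{(m)}\big)=\mathrm{tr}\big(\omega^{(m-1)}_{\mathrm{GGE}}Q_i^{(m)}\big)\qquad\text{for all } i=1,\dots,q,$$ form in the limit $N\to\infty$ a set of smooth functions $u\mapsto\lambda_j(u)$ for $j=1,\dots,q$.
   Context: $S(\rho)=-\mathrm{tr}(\rho\log\rho)$ is the von Neumann entropy. GGE equilibration model: for a Hamiltonian $H$ with a chosen set of $q$ conserved quantities $Q_1,\dots,Q_q$ (in general not all conserved quantities), the equilibrium state $\Omega_{\mathrm{GGE}}(\rho,H,\{Q_i\})$ reached from a state $\rho$ is the state maximising $S(\sigma)$ among all states $\sigma$ having the same expectation values as $\rho$ of the conserved quantities, the energy $H$ being counted among them. It has the form $\Omega_{\mathrm{GGE}}\propto\exp\big(\sum_{j=1}^q\lambda_jQ_j\big)$, where the Lagrange multipliers $\lambda_j$ are fixed by the conservation of the expectation values; if $H$ is listed as one of the $Q_j$, its multiplier is $-\beta$, with $\beta$ the inverse temperature. Quasi-static process: one considers $N$ quenches $H^{(m-1)}\mapsto H^{(m)}$, $m=1,\dots,N$, with $H^{(m)}=H(m/N)$ and $H^{(m+1)}-H^{(m)}$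 of order $1/N$. Each quench leaves the state unchanged and is followed by an equilibration, so that $\omega^{(m)}_{\mathrm{GGE}}=\Omega_{\mathrm{GGE}}\big(\omega^{(m-1)}_{\mathrm{GGE}},H^{(m)},\{Q_i^{(m)}\}\big)$, where $Q_1^{(m)},\dots,Q_q^{(m)}$ are the $q$ conserved quantities of $H^{(m)}$ and $\lambda_j^{(m)}$ are the Lagrange multipliers of $\omega^{(m)}_{\mathrm{GGE}}$. The quasi-static process is the limit $N\to\infty$, in which one writes $\omega_{\mathrm{GGE}}(u=m/N)=\omega^{(m)}_{\mathrm{GGE}}$.
   Formalization: Systems are finite-dimensional, and the changes of all conserved quantities Q_i between successive quenches, not only of H, are assumed to be of order 1/N; if a Q_i may jump, the entropy can jump although the Lagrange multipliers stay constant. *)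

theory Defs
  imports "HOL-Analysis.Analysis"
begin

section \<open>Hermitian matrices and functional calculus\<close>

definition mat_adjoint :: "complex^'n^'n \<Rightarrow> complex^'n^'n" where
  "mat_adjoint A = (\<chi> i j. cnj (A $ j $ i))"

definition hermitian_mat :: "complex^'n^'n \<Rightarrow> bool" where
  "hermitian_mat A \<longleftrightarrow> mat_adjoint A = A"

definition unitary_mat :: "complex^'n^'n \<Rightarrow> bool" where
  "unitary_mat U \<longleftrightarrow> mat_adjoint U ** U = mat 1 \<and> U ** mat_adjoint U = mat 1"

definition real_diag :: "('n \<Rightarrow> real) \<Rightarrow> complex^'n^'n" where
  "real_diag d = (\<chi> i j. if i = j then complex_of_real (d i) else 0)"

text \<open>The matrix \<open>f(A)\<close> for Hermitian \<open>A\<close>. The value does not depend on the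
  diagonalisation used, so the description is proper.\<close>

definition herm_fun :: "(real \<Rightarrow> real) \<Rightarrow> complex^'n^'n \<Rightarrow> complex^'n^'n" where
  "herm_fun f A = (THE B. \<exists>U d. unitary_mat U \<and>
      A = U ** real_diag d ** mat_adjoint U \<and>
      B = U ** real_diag (\<lambda>i. f (d i)) ** mat_adjoint U)"

definition mat_log :: "complex^'n^'n \<Rightarrow> complex^'n^'n" where
  "mat_log A = herm_fun ln A"

definition mat_pow :: "complex^'n^'n \<Rightarrow> nat \<Rightarrow> complex^'n^'n" where
  "mat_pow A k = (((**) A) ^^ k) (mat 1)"

definition mat_exp :: "complex^'n^'n \<Rightarrow> complex^'n^'n" where
  "mat_exp A = (\<Sum>k. (1 / fact k) *\<^sub>R mat_pow A k)"


section \<open>States and entropy\<close>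

definition pos_semidef :: "complex^'n^'n \<Rightarrow> bool" where
  "pos_semidef A \<longleftrightarrow> hermitian_mat A \<and>
     (\<forall>v. 0 \<le> Re (\<Sum>i\<in>UNIV. cnj (v $ i) * (A *v v) $ i))"

definition state :: "complex^'n^'n \<Rightarrow> bool" where
  "state \<rho> \<longleftrightarrow> pos_semidef \<rho> \<and> trace \<rho> = 1"

text \<open>A zero eigenvalue of \<open>\<rho>\<close> contributes 0, which is the usual convention
  \<open>0 log 0 = 0\<close>. For a state the trace below is real.\<close>

definition vn_entropy :: "complex^'n^'n \<Rightarrow> real" where
  "vn_entropy \<rho> = - Re (trace (\<rho> ** mat_log \<rho>))"


section \<open>Generalised Gibbs ensembles\<close>

definition conserved_quantity :: "complex^'n^'n \<Rightarrow> complex^'n^'n \<Rightarrow> bool" where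
  "conserved_quantity H A \<longleftrightarrow> hermitian_mat A \<and> A ** H = H ** A"

definition same_expectations ::
    "complex^'n^'n \<Rightarrow> nat \<Rightarrow> (nat \<Rightarrow> complex^'n^'n) \<Rightarrow> complex^'n^'n \<Rightarrow> complex^'n^'n \<Rightarrow> bool" where
  "same_expectations H q Q \<rho> \<sigma> \<longleftrightarrow>
     trace (\<sigma> ** H) = trace (\<rho> ** H) \<and>
     (\<forall>i\<in>{1..q}. trace (\<sigma> ** Q i) = trace (\<rho> ** Q i))"

text \<open>\<open>gge_equilibrium H q Q \<rho> \<sigma>\<close> says that \<open>\<sigma>\<close> is the equilibrium state
  \<open>\<Omega>\<^sub>G\<^sub>G\<^sub>E(\<rho>, H, {Q\<^sub>1, \<dots>, Q\<^sub>q})\<close>. The maximiser is unique since the entropy is strictly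
  concave. The energy constraint is always imposed, whether or not \<open>H\<close> is
  one of the \<open>Q\<^sub>i\<close>; when it is, the constraint is simply repeated.\<close>

definition gge_equilibrium ::
    "complex^'n^'n \<Rightarrow> nat \<Rightarrow> (nat \<Rightarrow> complex^'n^'n) \<Rightarrow> complex^'n^'n \<Rightarrow> complex^'n^'n \<Rightarrow> bool" where
  "gge_equilibrium H q Q \<rho> \<sigma> \<longleftrightarrow>
     state \<sigma> \<and> same_expectations H q Q \<rho> \<sigma> \<and>
     (\<forall>\<tau>. state \<tau> \<and> same_expectations H q Q \<rho> \<tau> \<longrightarrow> vn_entropy \<tau> \<le> vn_entropy \<sigma>)"

definition gge_state ::
    "nat \<Rightarrow> (nat \<Rightarrow> complex^'n^'n) \<Rightarrow> (nat \<Rightarrow> real) \<Rightarrow> complex^'n^'n" where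
  "gge_state q Q l =
     (let E = mat_exp (\<Sum>j=1..q. l j *\<^sub>R Q j) in (1 / Re (trace E)) *\<^sub>R E)"


section \<open>Trajectories\<close>

definition steps_of_order_inverse :: "(real \<Rightarrow> complex^'n^'n) \<Rightarrow> bool" where
  "steps_of_order_inverse F \<longleftrightarrow>
     (\<exists>C. \<forall>N\<ge>1. \<forall>m<N. norm (F (real (m + 1) / real N) - F (real m / real N)) \<le> C / real N)"

text \<open>Infinitely differentiable on the closed interval, with one-sided derivatives
  at the end points; \<open>D k\<close> is the \<open>k\<close>-th derivative.\<close>

definition smooth_on_unit :: "(real \<Rightarrow> real) \<Rightarrow> bool" where
  "smooth_on_unit f \<longleftrightarrow>
     (\<exists>D :: nat \<Rightarrow> real \<Rightarrow> real. D 0 = f \<and>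
        (\<forall>k. \<forall>u\<in>{0..1}. (D k has_real_derivative D (Suc k) u) (at u within {0..1})))"

text \<open>\<open>x N m\<close> is a quantity attached to step \<open>m\<close> of the process with \<open>N\<close> quenches;
  step \<open>\<lfloor>u N\<rfloor>\<close> is step \<open>m\<close> when \<open>u = m / N\<close>.\<close>

definition quasi_static_limit ::
    "(nat \<Rightarrow> nat \<Rightarrow> 'a::topological_space) \<Rightarrow> (real \<Rightarrow> 'a) \<Rightarrow> bool" where
  "quasi_static_limit x y \<longleftrightarrow>
     (\<forall>u\<in>{0..1}. (\<lambda>N. x N (nat \<lfloor>u * real N\<rfloor>)) \<longlonglongrightarrow> y u)"

text \<open>The process with \<open>N\<close> quenches started from \<open>\<rho>\<^sub>0\<close>: \<open>\<omega> m\<close> is the state after the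
  \<open>m\<close>-th equilibration and \<open>l m j\<close> its \<open>j\<close>-th Lagrange multiplier. The system is
  initially equilibrated with respect to \<open>H 0\<close>, so that \<open>\<omega> 0\<close> is a GGE state, too.\<close>

definition gge_quench_process ::
    "(real \<Rightarrow> complex^'n^'n) \<Rightarrow> nat \<Rightarrow> (nat \<Rightarrow> real \<Rightarrow> complex^'n^'n) \<Rightarrow> complex^'n^'n \<Rightarrow>
     nat \<Rightarrow> (nat \<Rightarrow> complex^'n^'n) \<Rightarrow> (nat \<Rightarrow> nat \<Rightarrow> real) \<Rightarrow> bool" where
  "gge_quench_process H q Q \<rho>\<^sub>0 N \<omega> l \<longleftrightarrow>
     gge_equilibrium (H 0) q (\<lambda>i. Q i 0) \<rho>\<^sub>0 (\<omega> 0) \<and>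
     (\<forall>m\<in>{1..N}. gge_equilibrium (H (real m / real N)) q (\<lambda>i. Q i (real m / real N))
                    (\<omega> (m - 1)) (\<omega> m)) \<and>
     (\<forall>m\<in>{0..N}. \<omega> m = gge_state q (\<lambda>i. Q i (real m / real N)) (l m))"

end

(* Write g(A) for exp(A) / tr exp(A) and P(a,b) for the sum of l_j(a) Q_j(b). The entropy does not
   decrease along the process, because the previous state always is an admissible candidate for
   the maximiser. Conversely, freeze the multipliers at step a. The Gibbs variational principle
   S(rho) + tr(rho A) <= ln tr exp(A), with equality for rho = g(A), bounds the entropy gained
   between steps a and b by the sum over the steps m in between of
   tr((g(P(a,b)) - w_m) (P(a,m+1) - P(a,m))), where the differences of P are O(1/N). In the limit
   the gain is at most a constant times the integral from a to b of |g(P(a,b)) - w(u)| du (the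
   convergence is only pointwise, so this is dominated convergence). As w(u) = g(P(u,u)) depends
   continuously on u, that integral is o(b-a), and summing over a fine partition of [0,1] gives
   S(w(1)) <= S(w(0)). *)

theory Submission
  imports Defs
begin

section \<open>The spectral theorem\<close>

text \<open>The obvious plan, a gain of order 1/N^2 for each quench summed over N quenches, would
  need neighbouring multipliers to differ by O(1/N). At finite N nothing is known about these
  differences: the multipliers converge only pointwise. Hence the intermediate scale: a cell
  [i/k, (i+1)/k] is kept fixed while N tends to infinity, and only afterwards is the partition
  refined. With the multipliers of the left end used throughout a cell, the exponents change only
  through the conserved quantities.

  A second obstacle is that the step condition controls the Q_j at rational points only. They are
  replaced by Lipschitz extensions from these points, which agree with them on every grid; at
  irrational u the limit state is the Gibbs state of the extensions.\<close>

lemma mat_adjoint_nth [simp]: "mat_adjoint A $ i $ j = cnj (A $ j $ i)"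
  by (simp add: mat_adjoint_def)

lemma mat_adjoint_mult: "mat_adjoint (A ** B) = mat_adjoint B ** mat_adjoint A"
  by (simp add: vec_eq_iff matrix_matrix_mult_def mult.commute)

lemma mat_adjoint_adjoint [simp]: "mat_adjoint (mat_adjoint A) = A"
  by (simp add: vec_eq_iff)

lemma hermitian_mat_nth: "hermitian_mat A \<longleftrightarrow> (\<forall>i j. cnj (A $ j $ i) = A $ i $ j)"
  by (simp add: hermitian_mat_def vec_eq_iff)

lemma hermitian_mat_sum_scaleR:
  assumes "\<And>j. j \<in> J \<Longrightarrow> hermitian_mat (Q j)"
  shows "hermitian_mat (\<Sum>j\<in>J. (l j :: real) *\<^sub>R Q j)"
  using assms by (simp add: hermitian_mat_nth)

lemma hermitian_mat_LIMSEQ: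
  assumes lim: "X \<longlonglongrightarrow> A" and herm: "\<And>n. hermitian_mat (X n)"
  shows "hermitian_mat A"
  unfolding hermitian_mat_nth
proof (intro allI)
  fix i j
  have "(\<lambda>n. X n $ i $ j) \<longlonglongrightarrow> A $ i $ j"
    by (intro tendsto_vec_nth lim)
  moreover have "(\<lambda>n. cnj (X n $ j $ i)) \<longlonglongrightarrow> cnj (A $ j $ i)"
    by (intro tendsto_cnj tendsto_vec_nth lim)
  moreover have "cnj (X n $ j $ i) = X n $ i $ j" for n
    using herm[of n] by (simp add: hermitian_mat_nth)
  ultimately show "cnj (A $ j $ i) = A $ i $ j"
    using LIMSEQ_unique by auto
qed

text \<open>Unitarity of the eigenvector matrix asks for orthogonality over the complex numbers,
  while the compactness and dimension arguments run in the real space with \<open>inner\<close>.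
  Real and imaginary part of \<open>cinner\<close> link the two.\<close>

definition cinner :: "complex^'n \<Rightarrow> complex^'n \<Rightarrow> complex" where
  "cinner x y = (\<Sum>i\<in>UNIV. cnj (x $ i) * y $ i)"

lemma inner_eq_Re_cinner: "inner x y = Re (cinner x y)"
  by (simp add: inner_vec_def cinner_def inner_complex_def)

lemma inner_ii_eq_Im_cinner: "inner (\<i> *s x) y = Im (cinner x y)"
  by (simp add: inner_vec_def cinner_def inner_complex_def)

lemma cinner_commute: "cinner y x = cnj (cinner x y)"
  by (simp add: cinner_def mult.commute)

lemma cinner_self: "cinner x x = complex_of_real ((norm x)\<^sup>2)"
proof (rule complex_eqI)
  show "Re (cinner x x) = Re (complex_of_real ((norm x)\<^sup>2))"
    by (simp add: power2_norm_eq_inner inner_eq_Re_cinner)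
  show "Im (cinner x x) = Im (complex_of_real ((norm x)\<^sup>2))"
    by (simp add: cinner_def)
qed

lemma cinner_add_right: "cinner x (y + z) = cinner x y + cinner x z"
  by (simp add: cinner_def algebra_simps sum.distrib)

lemma cinner_scaleR_right: "cinner x (r *\<^sub>R y) = r *\<^sub>R cinner x y"
  by (simp add: cinner_def scaleR_sum_right)

lemma cinner_mat_adjoint: "cinner x (A *v y) = cinner (mat_adjoint A *v x) y"
proof -
  have "cinner x (A *v y) = (\<Sum>i\<in>UNIV. \<Sum>j\<in>UNIV. cnj (x $ i) * A $ i $ j * y $ j)"
    by (simp add: cinner_def matrix_vector_mult_def sum_distrib_left mult.assoc)
  also have "\<dots> = (\<Sum>j\<in>UNIV. \<Sum>i\<in>UNIV. cnj (x $ i) * A $ i $ j * y $ j)"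
    by (rule sum.swap)
  also have "\<dots> = cinner (mat_adjoint A *v x) y"
    by (simp add: cinner_def matrix_vector_mult_def sum_distrib_left sum_distrib_right mult_ac)
  finally show ?thesis .
qed

lemma continuous_on_cinner [continuous_intros]:
  "continuous_on S (cinner x)"
  unfolding cinner_def by (intro continuous_intros)

lemma continuous_on_matrix_vector_mult:
  "continuous_on S (\<lambda>x. (A :: complex^'n^'m) *v x)"
  unfolding matrix_vector_mult_def by (intro continuous_intros continuous_on_vec_lambda)

lemma matrix_vector_mult_scaleR_right: "(A :: complex^'n^'m) *v (r *\<^sub>R x) = r *\<^sub>R (A *v x)"
  by (simp add: matrix_vector_mult_def vec_eq_iff scaleR_sum_right)

text \<open>A maximiser of the Rayleigh quotient on an invariant subspace is an eigenvector.\<close>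

lemma hermitian_eigenvector:
  fixes A :: "complex^'n^'n" and W :: "(complex^'n) set"
  assumes A: "hermitian_mat A" and W: "subspace W" and cl: "closed W"
    and inv: "\<And>x. x \<in> W \<Longrightarrow> A *v x \<in> W" and nz: "\<exists>x\<in>W. x \<noteq> 0"
  shows "\<exists>v\<in>W. \<exists>\<mu>::real. norm v = 1 \<and> A *v v = \<mu> *\<^sub>R v"
proof -
  define R where "R x = inner x (A *v x)" for x
  have sym: "inner x (A *v y) = inner y (A *v x)" for x y
    using A by (metis cinner_mat_adjoint hermitian_mat_def inner_commute inner_eq_Re_cinner)
  obtain x0 where x0: "x0 \<in> W" "x0 \<noteq> 0" using nz by blast
  define T where "T = sphere 0 1 \<inter> W"
  have "compact T" unfolding T_def by (intro compact_Int_closed compact_sphere cl)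
  moreover have "(1 / norm x0) *\<^sub>R x0 \<in> T"
    using x0 W by (auto simp: T_def subspace_def)
  hence "T \<noteq> {}" by blast
  moreover have "continuous_on T R"
    unfolding R_def by (intro continuous_intros continuous_on_matrix_vector_mult)
  ultimately obtain v where v: "v \<in> T" and vmax: "\<And>y. y \<in> T \<Longrightarrow> R y \<le> R v"
    using continuous_attains_sup[of T R] by blast
  define \<mu> where "\<mu> = R v"
  have vW: "v \<in> W" and nv: "norm v = 1" using v by (auto simp: T_def)
  have bound: "R x \<le> \<mu> * (norm x)\<^sup>2" if "x \<in> W" for x
  proof (cases "x = 0")
    case True
    then show ?thesis by (simp add: R_def)
  next
    case False
    have "(1 / norm x) *\<^sub>R x \<in> T"
      using that False W by (auto simp: T_def subspace_def)
    hence "R ((1 / norm x) *\<^sub>R x) \<le> \<mu>" using vmax \<mu>_def by blast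
    moreover have "R ((1 / norm x) *\<^sub>R x) = R x / (norm x)\<^sup>2"
      by (simp add: R_def matrix_vector_mult_scaleR_right power2_eq_square)
    ultimately show ?thesis using False by (simp add: divide_le_eq)
  qed
  define y where "y = A *v v - \<mu> *\<^sub>R v"
  have yW: "y \<in> W"
    unfolding y_def using W vW inv by (intro subspace_diff subspace_scale) auto
  \<comment> \<open>Expand the maximality bound at \<open>v + t *\<^sub>R y\<close>: the residual
    \<open>y\<close> contributes exactly \<open>2 * t * (norm y)\<^sup>2\<close> at first order in
    \<open>t\<close>, and the rest is of second order.\<close>
  have key: "2 * t * (norm y)\<^sup>2 \<le> t\<^sup>2 * (\<mu> * (norm y)\<^sup>2 - R y)" for t :: real
  proof -
    have "R (v + t *\<^sub>R y) \<le> \<mu> * (norm (v + t *\<^sub>R y))\<^sup>2"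
      using bound W vW yW by (simp add: subspace_def)
    moreover have "R (v + t *\<^sub>R y) = \<mu> + 2 * t * inner y (A *v v) + t\<^sup>2 * R y"
      using sym[of v y]
      by (simp add: R_def \<mu>_def matrix_vector_right_distrib matrix_vector_mult_scaleR_right
          inner_add_left inner_add_right algebra_simps power2_eq_square)
    moreover have "(norm (v + t *\<^sub>R y))\<^sup>2 = 1 + 2 * t * inner y v + t\<^sup>2 * (norm y)\<^sup>2"
      using nv unfolding power2_norm_eq_inner norm_eq_1
      by (simp add: inner_add_left inner_add_right inner_commute[of v y] algebra_simps power2_eq_square)
    moreover have "inner y (A *v v) = (norm y)\<^sup>2 + \<mu> * inner y v"
      unfolding power2_norm_eq_inner by (subst (3) y_def) (simp add: inner_diff_right)
    ultimately show ?thesis by (simp add: algebra_simps)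
  qed
  have "(norm y)\<^sup>2 \<le> 0"
  proof (rule ccontr)
    assume "\<not> (norm y)\<^sup>2 \<le> 0"
    define a where "a = (norm y)\<^sup>2"
    \<comment> \<open>\<open>b\<close> is positive and dominates the second-order coefficient; at
      \<open>t = a / b\<close> the inequality \<open>key\<close> would give
      \<open>2 * a \<le> a\<close>.\<close>
    define b where "b = \<bar>\<mu> * (norm y)\<^sup>2 - R y\<bar> + 1"
    have a: "a > 0" and b: "b > 0" using \<open>\<not> (norm y)\<^sup>2 \<le> 0\<close> by (auto simp: a_def b_def)
    have "2 * (a / b) * a \<le> (a / b)\<^sup>2 * (\<mu> * (norm y)\<^sup>2 - R y)"
      using key[of "a / b"] by (simp add: a_def)
    also have "\<dots> \<le> (a / b)\<^sup>2 * b"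
      by (intro mult_left_mono) (auto simp: b_def)
    also have "\<dots> = (a / b) * a"
      using b by (simp add: power2_eq_square)
    finally show False using a b by (simp add: field_simps)
  qed
  hence "y = 0" by simp
  thus ?thesis using vW nv y_def by auto
qed

text \<open>Induction on \<open>S\<close>: the complex orthogonal complement \<open>W\<close> of the
  eigenvectors found so far is invariant because \<open>A\<close> is hermitian, so it contains a
  further one. Indexing by subsets of \<open>'n\<close> lets the full family become the columns of a
  matrix.\<close>

lemma hermitian_orthonormal_eigenvectors:
  fixes A :: "complex^'n^'n" and S :: "'n set"
  assumes A: "hermitian_mat A"
  shows "\<exists>e d. (\<forall>i\<in>S. \<forall>j\<in>S. cinner (e i) (e j) = (if i = j then 1 else 0)) \<and>
           (\<forall>i\<in>S. A *v e i = (d i :: real) *\<^sub>R e i)"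
  using finite[of S]
proof (induction S rule: finite_induct)
  case empty
  then show ?case by simp
next
  case (insert s S)
  then obtain e d where e: "\<And>i j. i \<in> S \<Longrightarrow> j \<in> S \<Longrightarrow> cinner (e i) (e j) = (if i = j then 1 else 0)"
    and d: "\<And>i. i \<in> S \<Longrightarrow> A *v e i = (d i :: real) *\<^sub>R e i" by blast
  define W where "W = (\<Inter>i\<in>S. {v. cinner (e i) v = 0})"
  have sub: "subspace W"
    by (auto simp: W_def subspace_def cinner_add_right cinner_scaleR_right) (simp add: cinner_def)
  have cl: "closed W"
    unfolding W_def by (intro closed_INT ballI closed_Collect_eq continuous_intros)
  have inv: "A *v x \<in> W" if "x \<in> W" for x
  proof -
    have "cinner (e i) (A *v x) = 0" if i: "i \<in> S" for i
    proof -
      have "cinner (e i) (A *v x) = cinner (d i *\<^sub>R e i) x"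
        using A d[OF i] by (simp add: cinner_mat_adjoint hermitian_mat_def)
      also have "\<dots> = d i *\<^sub>R cinner (e i) x"
        by (simp add: cinner_def scaleR_sum_right)
      also have "\<dots> = 0" using \<open>x \<in> W\<close> i by (simp add: W_def)
      finally show ?thesis .
    qed
    thus ?thesis by (simp add: W_def)
  qed
  have nz: "\<exists>x\<in>W. x \<noteq> 0"
  proof -
    \<comment> \<open>Complex orthogonality to the \<open>e i\<close> is real orthogonality to the
      at most \<open>2 * card S\<close> vectors \<open>e i\<close> and \<open>\<i> *s e i\<close>,
      fewer than the real dimension \<open>2 * CARD('n)\<close>.\<close>
    define B where "B = e ` S \<union> (\<lambda>i. \<i> *s e i) ` S"
    have "card B \<le> card S + card S"
      unfolding B_def by (rule order.trans[OF card_Un_le]) (intro add_mono card_image_le finite)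
    moreover have "card S < CARD('n)"
      using insert.hyps by (metis UNIV_I finite psubset_card_mono psubsetI subset_UNIV)
    ultimately have "card B < DIM(complex^'n)" by simp
    moreover have "finite B" by (simp add: B_def)
    ultimately have "dim B < DIM(complex^'n)"
      using dim_le_card'[of B] by linarith
    then obtain x where x: "x \<noteq> 0" "\<And>y. y \<in> span B \<Longrightarrow> orthogonal x y"
      using orthogonal_to_subspace_exists[of B] by blast
    have "cinner (e i) x = 0" if "i \<in> S" for i
    proof (rule complex_eqI)
      have "e i \<in> span B" "\<i> *s e i \<in> span B"
        using that by (auto simp: B_def intro!: span_base)
      hence "inner (e i) x = 0" "inner (\<i> *s e i) x = 0"
        using x(2) by (metis orthogonal_commute orthogonal_def)+
      thus "Re (cinner (e i) x) = Re 0" "Im (cinner (e i) x) = Im 0"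
        by (auto simp: inner_eq_Re_cinner inner_ii_eq_Im_cinner[symmetric])
    qed
    thus ?thesis using x(1) by (auto simp: W_def)
  qed
  obtain v \<mu> where v: "v \<in> W" "norm v = 1" "A *v v = (\<mu>::real) *\<^sub>R v"
    using hermitian_eigenvector[OF A sub cl inv nz] by blast
  have vo: "cinner (e i) v = 0" "cinner v (e i) = 0" if "i \<in> S" for i
    using v(1) that cinner_commute[of v "e i"] by (auto simp: W_def)
  have "cinner v v = 1" using v(2) by (simp add: cinner_self)
  then show ?case
    using e d v(3) vo insert.hyps
    by (intro exI[of _ "e(s := v)"] exI[of _ "d(s := \<mu>)"]) auto
qed

theorem hermitian_spectral:
  fixes A :: "complex^'n^'n"
  assumes A: "hermitian_mat A"
  obtains U d where "unitary_mat U" "A = U ** real_diag d ** mat_adjoint U"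
proof -
  obtain e :: "'n \<Rightarrow> complex^'n" and d where e: "\<forall>i j. cinner (e i) (e j) = (if i = j then 1 else 0)"
    and d: "\<forall>i. A *v e i = (d i :: real) *\<^sub>R e i"
    using hermitian_orthonormal_eigenvectors[OF A, of UNIV] by auto
  define U :: "complex^'n^'n" where "U = (\<chi> k i. e i $ k)"
  have "mat_adjoint U ** U = mat 1"
    using e by (simp add: vec_eq_iff matrix_matrix_mult_def mat_def U_def cinner_def)
  moreover from this have UU: "U ** mat_adjoint U = mat 1"
    by (simp add: matrix_left_right_inverse)
  moreover have "A ** U = U ** real_diag d"
  proof -
    have "(A ** U) $ k $ i = (U ** real_diag d) $ k $ i" for k i
    proof -
      have "(A ** U) $ k $ i = (A *v e i) $ k"
        by (simp add: matrix_matrix_mult_def matrix_vector_mult_def U_def)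
      also have "\<dots> = (U ** real_diag d) $ k $ i"
        by (simp add: d matrix_matrix_mult_def real_diag_def U_def if_distrib
            scaleR_conv_of_real[where 'a = complex] mult.commute cong: if_cong)
      finally show ?thesis .
    qed
    thus ?thesis by (simp add: vec_eq_iff)
  qed
  hence "A = U ** real_diag d ** mat_adjoint U"
    by (metis UU matrix_mul_assoc matrix_mul_rid)
  ultimately show ?thesis using that by (simp add: unitary_mat_def)
qed

section \<open>Functional calculus and the Gibbs variational principle\<close>

lemma real_diag_mult_nth: "(real_diag a ** X) $ i $ j = a i * X $ i $ j"
proof -
  have "(real_diag a ** X) $ i $ j = (\<Sum>k\<in>UNIV. if i = k then a i * X $ k $ j else 0)"
    unfolding matrix_matrix_mult_def real_diag_def vec_lambda_beta by (rule sum.cong) auto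
  thus ?thesis by simp
qed

lemma mult_real_diag_nth: "(X ** real_diag a) $ i $ j = X $ i $ j * a j"
proof -
  have "(X ** real_diag a) $ i $ j = (\<Sum>k\<in>UNIV. if k = j then X $ i $ k * a j else 0)"
    unfolding matrix_matrix_mult_def real_diag_def vec_lambda_beta by (rule sum.cong) auto
  thus ?thesis by simp
qed

lemma real_diag_mult_vec_nth: "(real_diag a *v x) $ i = a i * x $ i"
proof -
  have "(real_diag a *v x) $ i = (\<Sum>k\<in>UNIV. if i = k then a i * x $ k else 0)"
    unfolding matrix_vector_mult_def real_diag_def vec_lambda_beta by (rule sum.cong) auto
  thus ?thesis by simp
qed

lemma real_diag_mult: "real_diag a ** real_diag b = real_diag (\<lambda>i. a i * b i)"
  by (simp add: vec_eq_iff real_diag_mult_nth) (simp add: real_diag_def)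

lemma real_diag_one: "real_diag (\<lambda>i. 1) = mat 1"
  by (simp add: vec_eq_iff real_diag_def mat_def)

lemma trace_real_diag: "trace (real_diag d) = complex_of_real (\<Sum>i\<in>UNIV. d i)"
  by (simp add: trace_def real_diag_def)

lemma unitary_conj_mult:
  assumes "unitary_mat U"
  shows "(U ** X ** mat_adjoint U) ** (U ** Y ** mat_adjoint U) = U ** (X ** Y) ** mat_adjoint U"
proof -
  have "(U ** X ** mat_adjoint U) ** (U ** Y ** mat_adjoint U)
      = U ** X ** (mat_adjoint U ** U) ** Y ** mat_adjoint U"
    by (simp add: matrix_mul_assoc)
  also have "\<dots> = U ** X ** Y ** mat_adjoint U"
    using assms by (simp add: unitary_mat_def)
  finally show ?thesis by (simp add: matrix_mul_assoc)
qed

lemma trace_unitary_conj: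
  assumes "unitary_mat U"
  shows "trace (U ** X ** mat_adjoint U) = trace X"
proof -
  have "trace (U ** X ** mat_adjoint U) = trace (mat_adjoint U ** U ** X)"
    by (metis matrix_mul_assoc trace_mul_sym)
  thus ?thesis using assms by (simp add: unitary_mat_def)
qed

lemma unitary_conj_real_diag_nth:
  "(U ** real_diag d ** mat_adjoint U) $ i $ j = (\<Sum>k\<in>UNIV. U $ i $ k * cnj (U $ j $ k) * d k)"
  by (simp add: matrix_matrix_mult_def real_diag_def if_distrib mult_ac cong: if_cong)

lemma hermitian_unitary_conj_real_diag: "hermitian_mat (U ** real_diag d ** mat_adjoint U)"
  by (simp add: hermitian_mat_nth unitary_conj_real_diag_nth mult_ac)

lemma scaleR_unitary_conj_real_diag:
  "r *\<^sub>R (U ** real_diag d ** mat_adjoint U) = U ** real_diag (\<lambda>i. r * d i) ** mat_adjoint U"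
  by (simp add: vec_eq_iff unitary_conj_real_diag_nth sum_distrib_left
      scaleR_conv_of_real[where 'a = complex] mult_ac)

lemma unitary_mat_mult_adjoint:
  assumes "unitary_mat U" "unitary_mat V"
  shows "unitary_mat (mat_adjoint U ** V)"
proof -
  have "mat_adjoint V ** U ** (mat_adjoint U ** V) = mat_adjoint V ** (U ** mat_adjoint U) ** V"
    "mat_adjoint U ** V ** (mat_adjoint V ** U) = mat_adjoint U ** (V ** mat_adjoint V) ** U"
    by (simp_all add: matrix_mul_assoc)
  thus ?thesis using assms by (simp add: unitary_mat_def mat_adjoint_mult)
qed

text \<open>\<open>W = V\<^sup>* U\<close> intertwines the two diagonal matrices, so \<open>W $ i $ j\<close> vanishes unless
  \<open>d j = d' i\<close>; hence it also intertwines their images under \<open>f\<close>.\<close>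

lemma herm_fun_unique:
  assumes U: "unitary_mat U" and V: "unitary_mat V"
    and eq: "U ** real_diag d ** mat_adjoint U = V ** real_diag d' ** mat_adjoint V"
  shows "U ** real_diag (\<lambda>i. f (d i)) ** mat_adjoint U = V ** real_diag (\<lambda>i. f (d' i)) ** mat_adjoint V"
proof -
  define W where "W = mat_adjoint V ** U"
  have "mat_adjoint V ** (U ** real_diag d ** mat_adjoint U) ** U = W ** real_diag d"
    using U by (simp add: W_def unitary_mat_def flip: matrix_mul_assoc)
  moreover have "mat_adjoint V ** (V ** real_diag d' ** mat_adjoint V) ** U = real_diag d' ** W"
    using V by (simp add: W_def unitary_mat_def matrix_mul_assoc)
  ultimately have W: "W ** real_diag d = real_diag d' ** W" using eq by simp
  have "W $ i $ j * f (d j) = f (d' i) * W $ i $ j" for i j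
  proof -
    have "(W ** real_diag d) $ i $ j = (real_diag d' ** W) $ i $ j" using W by simp
    hence "W $ i $ j * d j = d' i * W $ i $ j"
      by (simp add: real_diag_mult_nth mult_real_diag_nth)
    thus ?thesis by (cases "W $ i $ j = 0") auto
  qed
  hence W': "W ** real_diag (\<lambda>i. f (d i)) = real_diag (\<lambda>i. f (d' i)) ** W"
    by (simp add: vec_eq_iff real_diag_mult_nth mult_real_diag_nth)
  have "U ** real_diag (\<lambda>i. f (d i)) ** mat_adjoint U
      = V ** (W ** real_diag (\<lambda>i. f (d i))) ** mat_adjoint U"
    using V by (simp add: W_def unitary_mat_def matrix_mul_assoc)
  also have "\<dots> = V ** real_diag (\<lambda>i. f (d' i)) ** mat_adjoint V"
    unfolding W' using U by (simp add: W_def unitary_mat_def flip: matrix_mul_assoc)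
  finally show ?thesis .
qed

lemma herm_fun_unitary_conj:
  assumes "unitary_mat U"
  shows "herm_fun f (U ** real_diag d ** mat_adjoint U) = U ** real_diag (\<lambda>i. f (d i)) ** mat_adjoint U"
  unfolding herm_fun_def
proof (rule the_equality)
  show "\<exists>U' d'. unitary_mat U' \<and> U ** real_diag d ** mat_adjoint U = U' ** real_diag d' ** mat_adjoint U' \<and>
      U ** real_diag (\<lambda>i. f (d i)) ** mat_adjoint U = U' ** real_diag (\<lambda>i. f (d' i)) ** mat_adjoint U'"
    using assms by blast
qed (use assms herm_fun_unique in metis)

lemma vn_entropy_unitary_conj:
  assumes "unitary_mat U"
  shows "vn_entropy (U ** real_diag p ** mat_adjoint U) = - (\<Sum>i\<in>UNIV. p i * ln (p i))"
  using assms
  by (simp add: vn_entropy_def mat_log_def herm_fun_unitary_conj unitary_conj_mult trace_unitary_conj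
      real_diag_mult trace_real_diag del: of_real_sum)

lemma mat_pow_unitary_conj:
  assumes "unitary_mat U"
  shows "mat_pow (U ** real_diag d ** mat_adjoint U) k = U ** real_diag (\<lambda>i. d i ^ k) ** mat_adjoint U"
proof (induction k)
  case 0
  show ?case using assms by (simp add: mat_pow_def unitary_mat_def real_diag_one)
next
  case (Suc k)
  then show ?case
    using assms by (simp add: mat_pow_def unitary_conj_mult real_diag_mult)
qed

lemma sums_vecI:
  fixes f :: "nat \<Rightarrow> 'a::real_normed_vector ^ 'n"
  assumes "\<And>i. (\<lambda>n. f n $ i) sums (s $ i)"
  shows "f sums s"
  using assms by (simp add: sums_def vec_tendstoI)

text \<open>Every matrix entry of the series is a finite combination of scalar exponential series,
  one for each eigenvalue.\<close>

lemma mat_exp_unitary_conj: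
  assumes "unitary_mat U"
  shows "mat_exp (U ** real_diag d ** mat_adjoint U) = U ** real_diag (\<lambda>i. exp (d i)) ** mat_adjoint U"
  unfolding mat_exp_def
proof (rule sums_unique[symmetric], intro sums_vecI)
  fix i j
  have "(\<lambda>n. d k ^ n /\<^sub>R fact n) sums exp (d k)" for k
    by (rule exp_converges)
  hence *: "(\<lambda>n. complex_of_real (1 / fact n * d k ^ n)) sums complex_of_real (exp (d k))" for k
    by (intro sums_of_real) (simp add: field_simps)
  have "(\<lambda>n. \<Sum>k\<in>UNIV. U $ i $ k * cnj (U $ j $ k) * complex_of_real (1 / fact n * d k ^ n))
      sums (\<Sum>k\<in>UNIV. U $ i $ k * cnj (U $ j $ k) * complex_of_real (exp (d k)))"
    by (intro sums_sum sums_mult *)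
  thus "(\<lambda>n. ((1 / fact n) *\<^sub>R mat_pow (U ** real_diag d ** mat_adjoint U) n) $ i $ j)
      sums ((U ** real_diag (\<lambda>i. exp (d i)) ** mat_adjoint U) $ i $ j)"
    unfolding mat_pow_unitary_conj[OF assms] scaleR_unitary_conj_real_diag
      unitary_conj_real_diag_nth .
qed

text \<open>The quadratic form takes the value \<open>p k\<close> at the \<open>k\<close>-th column
  of \<open>U\<close>.\<close>

lemma pos_semidef_unitary_conj_nonneg:
  assumes U: "unitary_mat U" and pos: "pos_semidef (U ** real_diag p ** mat_adjoint U)"
  shows "0 \<le> p k"
proof -
  define v where "v = U *v axis k 1"
  have Uv: "mat_adjoint U *v v = axis k 1"
    using U by (simp add: v_def matrix_vector_mul_assoc unitary_mat_def)
  have "cinner v ((U ** real_diag p ** mat_adjoint U) *v v)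
      = cinner (mat_adjoint U *v v) (real_diag p *v (mat_adjoint U *v v))"
    by (simp add: cinner_mat_adjoint flip: matrix_vector_mul_assoc)
  also have "\<dots> = p k"
    unfolding Uv by (simp add: cinner_def real_diag_mult_vec_nth axis_def if_distrib if_distribR cong: if_cong)
  finally show ?thesis
    using pos unfolding pos_semidef_def cinner_def by (metis Re_complex_of_real)
qed

section \<open>Overlaps of eigenbases and the variational principle\<close>

lemma unitary_mat_row_sum:
  assumes "unitary_mat W"
  shows "(\<Sum>j\<in>UNIV. (cmod (W $ i $ j))\<^sup>2) = 1"
proof -
  have "(W ** mat_adjoint W) $ i $ i = 1"
    using assms by (simp add: unitary_mat_def mat_def)
  hence "complex_of_real (\<Sum>j\<in>UNIV. (cmod (W $ i $ j))\<^sup>2) = 1"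
    by (simp add: matrix_matrix_mult_def complex_norm_square del: of_real_power)
  thus ?thesis using of_real_eq_1_iff by blast
qed

lemma unitary_mat_column_sum:
  assumes "unitary_mat W"
  shows "(\<Sum>i\<in>UNIV. (cmod (W $ i $ j))\<^sup>2) = 1"
  using unitary_mat_row_sum[of "mat_adjoint W" j] assms by (simp add: unitary_mat_def)

text \<open>For unitary \<open>V\<close> the squared moduli of the overlaps between the two
  eigenbases form a doubly stochastic matrix. A possibly noncommuting pair is thereby reduced to two
  spectra coupled by classical weights.\<close>

lemma trace_mult_unitary_conj:
  assumes U: "unitary_mat U"
  shows "trace ((U ** real_diag p ** mat_adjoint U) ** (V ** real_diag a ** mat_adjoint V))
    = complex_of_real (\<Sum>i\<in>UNIV. \<Sum>j\<in>UNIV. (cmod ((mat_adjoint U ** V) $ i $ j))\<^sup>2 * (p i * a j))"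
proof -
  define W where "W = mat_adjoint U ** V"
  have "(U ** real_diag p ** mat_adjoint U) ** (V ** real_diag a ** mat_adjoint V)
      = U ** (real_diag p ** (W ** real_diag a ** mat_adjoint W)) ** mat_adjoint U"
    using U by (simp add: W_def mat_adjoint_mult unitary_mat_def flip: matrix_mul_assoc)
  hence "trace ((U ** real_diag p ** mat_adjoint U) ** (V ** real_diag a ** mat_adjoint V))
      = trace (real_diag p ** (W ** real_diag a ** mat_adjoint W))"
    using U by (simp add: trace_unitary_conj)
  also have "\<dots> = (\<Sum>i\<in>UNIV. p i * (W ** real_diag a ** mat_adjoint W) $ i $ i)"
    by (simp add: trace_def real_diag_mult_nth)
  also have "\<dots> = complex_of_real (\<Sum>i\<in>UNIV. \<Sum>j\<in>UNIV. (cmod (W $ i $ j))\<^sup>2 * (p i * a j))"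
    by (simp add: unitary_conj_real_diag_nth complex_norm_square sum_distrib_left mult_ac
        del: of_real_power)
  finally show ?thesis by (simp add: W_def)
qed

text \<open>This is nonnegativity of the relative entropy of \<open>\<rho>\<close> with respect to
  the Gibbs state of \<open>A\<close>. It results from the scalar bound ln x \<le> x - 1 at
  \<open>x = exp (a j) / (Z * p i)\<close>, averaged with the overlap weights \<open>w\<close>,
  whose rows and columns sum to one.\<close>

theorem gibbs_variational:
  fixes \<rho> A :: "complex^'n^'n"
  assumes \<rho>: "state \<rho>" and A: "hermitian_mat A"
  shows "vn_entropy \<rho> + Re (trace (\<rho> ** A)) \<le> ln (Re (trace (mat_exp A)))"
proof -
  have "hermitian_mat \<rho>" using \<rho> by (simp add: state_def pos_semidef_def)
  then obtain U p where U: "unitary_mat U" and \<rho>_eq: "\<rho> = U ** real_diag p ** mat_adjoint U"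
    by (rule hermitian_spectral)
  obtain V a where V: "unitary_mat V" and A_eq: "A = V ** real_diag a ** mat_adjoint V"
    using A by (rule hermitian_spectral)
  define w where "w i j = (cmod ((mat_adjoint U ** V) $ i $ j))\<^sup>2" for i j
  define Z where "Z = (\<Sum>j\<in>UNIV. exp (a j))"
  have Z: "Z > 0" unfolding Z_def by (intro sum_pos) auto
  have p0: "p i \<ge> 0" for i
    using pos_semidef_unitary_conj_nonneg[OF U] \<rho> by (simp add: \<rho>_eq state_def)
  have p1: "(\<Sum>i\<in>UNIV. p i) = 1"
    using \<rho> U by (simp add: \<rho>_eq state_def trace_unitary_conj trace_real_diag del: of_real_sum)
  have W: "unitary_mat (mat_adjoint U ** V)" using U V by (rule unitary_mat_mult_adjoint)
  have row: "(\<Sum>j\<in>UNIV. w i j) = 1" and col: "(\<Sum>i\<in>UNIV. w i j) = 1" for i j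
    unfolding w_def using unitary_mat_row_sum[OF W] unitary_mat_column_sum[OF W] by auto
  have pw: "p i * (a j - ln Z - ln (p i)) \<le> exp (a j) / Z - p i" for i j
  proof (cases "p i = 0")
    case True
    then show ?thesis using Z by simp
  next
    case False
    hence pi: "p i > 0" using p0[of i] by simp
    have "ln (exp (a j) / Z / p i) \<le> exp (a j) / Z / p i - 1"
      using Z pi by (intro ln_le_minus_one) simp
    moreover have "ln (exp (a j) / Z / p i) = a j - ln Z - ln (p i)"
      using Z pi by (simp add: ln_div ln_mult)
    ultimately have "p i * (a j - ln Z - ln (p i)) \<le> p i * (exp (a j) / Z / p i - 1)"
      using pi by (intro mult_left_mono) auto
    also have "\<dots> = exp (a j) / Z - p i" using pi by (simp add: field_simps)
    finally show ?thesis .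
  qed
  have sum_row: "(\<Sum>i\<in>UNIV. \<Sum>j\<in>UNIV. w i j * g i) = (\<Sum>i\<in>UNIV. g i)" for g
    by (simp add: row flip: sum_distrib_right)
  have sum_col: "(\<Sum>i\<in>UNIV. \<Sum>j\<in>UNIV. w i j * g j) = (\<Sum>j\<in>UNIV. g j)" for g
    by (subst sum.swap) (simp add: col flip: sum_distrib_right)
  have "vn_entropy \<rho> + Re (trace (\<rho> ** A)) - ln Z
      = - (\<Sum>i\<in>UNIV. p i * ln (p i)) + (\<Sum>i\<in>UNIV. \<Sum>j\<in>UNIV. w i j * (p i * a j))
        - (\<Sum>i\<in>UNIV. p i * ln Z)"
    unfolding \<rho>_eq A_eq vn_entropy_unitary_conj[OF U] trace_mult_unitary_conj[OF U] Re_complex_of_real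
    by (simp add: w_def p1 flip: sum_distrib_right)
  also have "\<dots> = (\<Sum>i\<in>UNIV. \<Sum>j\<in>UNIV. w i j * (p i * (a j - ln Z - ln (p i))))"
    by (simp only: right_diff_distrib sum_subtractf sum_row)
  also have "\<dots> \<le> (\<Sum>i\<in>UNIV. \<Sum>j\<in>UNIV. w i j * (exp (a j) / Z - p i))"
    by (intro sum_mono mult_left_mono pw) (simp add: w_def)
  also have "\<dots> = (\<Sum>j\<in>UNIV. exp (a j) / Z) - (\<Sum>i\<in>UNIV. p i)"
    by (simp only: right_diff_distrib sum_subtractf sum_row sum_col)
  also have "\<dots> = 0"
    using Z p1 by (simp add: Z_def flip: sum_divide_distrib)
  finally show ?thesis
    using V by (simp add: A_eq mat_exp_unitary_conj trace_unitary_conj trace_real_diag Z_def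
        del: of_real_sum)
qed

text \<open>Depends on the exponent alone, so that the multipliers of one time can be paired with
  the conserved quantities of another.\<close>

definition gibbs :: "complex^'n^'n \<Rightarrow> complex^'n^'n" where
  "gibbs A = (1 / Re (trace (mat_exp A))) *\<^sub>R mat_exp A"

lemma gge_state_eq_gibbs: "gge_state q Q l = gibbs (\<Sum>j=1..q. l j *\<^sub>R Q j)"
  by (simp add: gge_state_def gibbs_def Let_def)

lemma trace_mat_exp_pos:
  assumes "hermitian_mat A"
  shows "Re (trace (mat_exp A)) > 0"
proof -
  obtain V a where V: "unitary_mat V" and A_eq: "A = V ** real_diag a ** mat_adjoint V"
    using assms by (rule hermitian_spectral)
  have "(\<Sum>j\<in>UNIV. exp (a j)) > 0" by (intro sum_pos) auto
  thus ?thesis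
    using V by (simp add: A_eq mat_exp_unitary_conj trace_unitary_conj trace_real_diag
        del: of_real_sum)
qed

lemma gibbs_diagonalisation:
  fixes A :: "complex^'n^'n"
  assumes "hermitian_mat A"
  obtains V a Z where "unitary_mat V" "A = V ** real_diag a ** mat_adjoint V"
    "Z = Re (trace (mat_exp A))" "Z > 0" "Z = (\<Sum>j\<in>UNIV. exp (a j))"
    "gibbs A = V ** real_diag (\<lambda>j. exp (a j) / Z) ** mat_adjoint V"
proof -
  obtain V a where V: "unitary_mat V" and A_eq: "A = V ** real_diag a ** mat_adjoint V"
    using assms by (rule hermitian_spectral)
  define Z where "Z = Re (trace (mat_exp A))"
  have Z: "Z > 0" unfolding Z_def using assms by (rule trace_mat_exp_pos)
  have Z_eq: "Z = (\<Sum>j\<in>UNIV. exp (a j))"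
    using V by (simp add: Z_def A_eq mat_exp_unitary_conj trace_unitary_conj trace_real_diag
        del: of_real_sum)
  have g: "gibbs A = V ** real_diag (\<lambda>j. exp (a j) / Z) ** mat_adjoint V"
    unfolding gibbs_def Z_def[symmetric]
    using V by (simp add: A_eq mat_exp_unitary_conj scaleR_unitary_conj_real_diag)
  show ?thesis by (rule that[OF V A_eq Z_def Z Z_eq g])
qed

text \<open>The equality case of \<open>gibbs_variational\<close>. It also expresses the entropy of
  a Gibbs state without \<open>mat_log\<close>, which reduces its continuity to that of
  \<open>mat_exp\<close>.\<close>

lemma vn_entropy_gibbs:
  fixes A :: "complex^'n^'n"
  assumes "hermitian_mat A"
  shows "vn_entropy (gibbs A) = ln (Re (trace (mat_exp A))) - Re (trace (gibbs A ** A))"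
proof -
  obtain V a Z where V: "unitary_mat V" and A_eq: "A = V ** real_diag a ** mat_adjoint V"
    and Z_def: "Z = Re (trace (mat_exp A))" and Z: "Z > 0" and Z_eq: "Z = (\<Sum>j\<in>UNIV. exp (a j))"
    and g: "gibbs A = V ** real_diag (\<lambda>j. exp (a j) / Z) ** mat_adjoint V"
    using assms by (rule gibbs_diagonalisation)
  have "vn_entropy (gibbs A) = - (\<Sum>j\<in>UNIV. exp (a j) / Z * (a j - ln Z))"
    unfolding g vn_entropy_unitary_conj[OF V] using Z by (simp add: ln_div)
  also have "\<dots> = (\<Sum>j\<in>UNIV. exp (a j)) / Z * ln Z - (\<Sum>j\<in>UNIV. exp (a j) / Z * a j)"
    by (simp add: right_diff_distrib sum_subtractf sum_distrib_right sum_divide_distrib)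
  also have "(\<Sum>j\<in>UNIV. exp (a j)) / Z = 1" using Z Z_eq by simp
  also have "(\<Sum>j\<in>UNIV. exp (a j) / Z * a j) = Re (trace (gibbs A ** A))"
  proof -
    have "gibbs A ** A = V ** real_diag (\<lambda>j. exp (a j) / Z * a j) ** mat_adjoint V"
      by (subst g, subst A_eq) (simp only: unitary_conj_mult[OF V] real_diag_mult)
    thus ?thesis by (simp add: trace_unitary_conj[OF V] trace_real_diag del: of_real_sum)
  qed
  finally show ?thesis by (simp add: Z_def)
qed

lemma state_gibbs:
  fixes A :: "complex^'n^'n"
  assumes "hermitian_mat A"
  shows "state (gibbs A)"
proof -
  obtain V a Z where V: "unitary_mat V" and A_eq: "A = V ** real_diag a ** mat_adjoint V"
    and Z_def: "Z = Re (trace (mat_exp A))" and Z: "Z > 0" and Z_eq: "Z = (\<Sum>j\<in>UNIV. exp (a j))"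
    and g: "gibbs A = V ** real_diag (\<lambda>j. exp (a j) / Z) ** mat_adjoint V"
    using assms by (rule gibbs_diagonalisation)
  have "trace (gibbs A) = 1"
    unfolding g trace_unitary_conj[OF V] trace_real_diag
    using Z Z_eq by (simp flip: sum_divide_distrib of_real_sum)
  moreover have "0 \<le> Re (\<Sum>i\<in>UNIV. cnj (v $ i) * (gibbs A *v v) $ i)" for v
  proof -
    define x where "x = mat_adjoint V *v v"
    have "(\<Sum>i\<in>UNIV. cnj (v $ i) * (gibbs A *v v) $ i) = cinner v (gibbs A *v v)"
      by (simp add: cinner_def)
    also have "\<dots> = cinner x (real_diag (\<lambda>j. exp (a j) / Z) *v x)"
      by (simp add: g x_def cinner_mat_adjoint flip: matrix_vector_mul_assoc)
    also have "\<dots> = (\<Sum>i\<in>UNIV. cnj (x $ i) * x $ i * (exp (a i) / Z))"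
      by (simp add: cinner_def real_diag_mult_vec_nth mult_ac)
    also have "\<dots> = complex_of_real (\<Sum>i\<in>UNIV. (cmod (x $ i))\<^sup>2 * (exp (a i) / Z))"
      by (simp add: complex_norm_square mult_ac del: of_real_power)
    finally show ?thesis using Z by (simp add: sum_nonneg)
  qed
  ultimately show ?thesis
    by (simp add: state_def pos_semidef_def g hermitian_unitary_conj_real_diag)
qed

section \<open>Continuity and limits\<close>

lemma bounded_bilinear_matrix_mult:
  "bounded_bilinear ((**) :: complex^'n^'n \<Rightarrow> complex^'n^'n \<Rightarrow> complex^'n^'n)"
  unfolding bilinear_conv_bounded_bilinear[symmetric] bilinear_def
  by (auto intro!: linearI simp: vec_eq_iff matrix_matrix_mult_def algebra_simps sum.distrib scaleR_sum_right)

lemma bounded_linear_Re_trace: "bounded_linear (\<lambda>A :: complex^'n^'n. Re (trace A))"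
  unfolding linear_conv_bounded_linear[symmetric]
  by (intro linearI) (auto simp: trace_def sum.distrib sum_distrib_left)

lemmas continuous_on_matrix_mult [continuous_intros] =
  bounded_bilinear.continuous_on[OF bounded_bilinear_matrix_mult]

lemmas continuous_on_Re_trace [continuous_intros] =
  bounded_linear.continuous_on[OF bounded_linear_Re_trace]

lemma bounded_bilinear_Re_trace_mult:
  "bounded_bilinear (\<lambda>A B :: complex^'n^'n. Re (trace (A ** B)))"
  unfolding bilinear_conv_bounded_bilinear[symmetric] bilinear_def
  by (auto intro!: linearI simp: trace_def matrix_matrix_mult_def algebra_simps sum.distrib
      sum_subtractf sum_distrib_left)

lemma continuous_on_mat_pow: "continuous_on S (\<lambda>A. mat_pow A k)"
  by (induction k) (auto simp: mat_pow_def intro!: continuous_intros)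

text \<open>Weierstrass test on each ball of radius \<open>r\<close>: there the series is dominated
  by the scalar exponential series at \<open>r * K\<close>, up to the factor
  \<open>norm (mat 1)\<close>, and the balls cover the space.\<close>

lemma continuous_on_mat_exp: "continuous_on UNIV (mat_exp :: complex^'n^'n \<Rightarrow> complex^'n^'n)"
proof -
  obtain K where K: "K > 0" "\<And>(A :: complex^'n^'n) (B :: complex^'n^'n). norm (A ** B) \<le> norm A * norm B * K"
    using bounded_bilinear.pos_bounded[OF bounded_bilinear_matrix_mult] by blast
  have pow: "norm (mat_pow A k) \<le> norm (mat 1 :: complex^'n^'n) * (norm A * K) ^ k"
    for A :: "complex^'n^'n" and k
  proof (induction k)
    case 0
    then show ?case by (simp add: mat_pow_def)
  next
    case (Suc k)
    have "norm (mat_pow A (Suc k)) \<le> norm A * norm (mat_pow A k) * K"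
      using K(2) by (simp add: mat_pow_def)
    also have "\<dots> \<le> norm A * (norm (mat 1 :: complex^'n^'n) * (norm A * K) ^ k) * K"
      using Suc K(1) by (intro mult_right_mono mult_left_mono) auto
    finally show ?case by (simp add: mult_ac)
  qed
  have "continuous_on (ball 0 r) (mat_exp :: complex^'n^'n \<Rightarrow> complex^'n^'n)" for r
  proof -
    have ul: "uniform_limit (ball 0 r) (\<lambda>n A. \<Sum>k<n. (1 / fact k) *\<^sub>R mat_pow A k)
        (\<lambda>A :: complex^'n^'n. \<Sum>k. (1 / fact k) *\<^sub>R mat_pow A k) sequentially"
    proof (rule Weierstrass_m_test)
      fix k and A :: "complex^'n^'n" assume "A \<in> ball 0 r"
      hence "norm (mat 1 :: complex^'n^'n) * (norm A * K) ^ k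
          \<le> norm (mat 1 :: complex^'n^'n) * (r * K) ^ k"
        using K(1) by (intro mult_left_mono power_mono mult_right_mono) auto
      hence "norm (mat_pow A k) \<le> norm (mat 1 :: complex^'n^'n) * (r * K) ^ k"
        using pow[of A k] by linarith
      thus "norm ((1 / fact k) *\<^sub>R mat_pow A k)
          \<le> norm (mat 1 :: complex^'n^'n) * ((r * K) ^ k /\<^sub>R fact k)"
        by (simp add: divide_simps)
    qed (intro summable_mult summable_exp_generic)
    have "continuous_on (ball 0 r) (\<lambda>A :: complex^'n^'n. \<Sum>k<n. (1 / fact k) *\<^sub>R mat_pow A k)" for n
      by (intro continuous_on_sum continuous_on_scaleR continuous_on_const continuous_on_mat_pow)
    hence "continuous_on (ball 0 r) (\<lambda>A :: complex^'n^'n. \<Sum>k. (1 / fact k) *\<^sub>R mat_pow A k)"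
      by (intro uniform_limit_theorem[OF _ ul trivial_limit_sequentially] always_eventually allI)
    thus ?thesis by (simp add: mat_exp_def[abs_def])
  qed
  hence "continuous_on (\<Union>r. ball 0 r) (mat_exp :: complex^'n^'n \<Rightarrow> complex^'n^'n)"
    by (intro continuous_on_open_UN) auto
  moreover have "(\<Union>r. ball 0 r) = (UNIV :: (complex^'n^'n) set)"
    using gt_ex by auto
  ultimately show ?thesis by simp
qed

lemmas continuous_on_mat_exp_compose [continuous_intros] =
  continuous_on_compose2[OF continuous_on_mat_exp _ subset_UNIV]

lemma continuous_on_gibbs: "continuous_on {A. hermitian_mat A} gibbs"
  unfolding gibbs_def[abs_def]
  by (intro continuous_intros) (auto dest: trace_mat_exp_pos)

lemma continuous_on_vn_entropy_gibbs: "continuous_on {A. hermitian_mat A} (\<lambda>A. vn_entropy (gibbs A))"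
proof -
  have "continuous_on {A. hermitian_mat A}
      (\<lambda>A. ln (Re (trace (mat_exp A))) - Re (trace (gibbs A ** A)))"
    by (intro continuous_intros continuous_on_gibbs) (auto dest: trace_mat_exp_pos)
  thus ?thesis by (rule continuous_on_eq) (simp add: vn_entropy_gibbs)
qed

text \<open>Supplies the constant majorant for dominated convergence. The eigenvalues form a
  probability vector and entries of a unitary matrix have modulus at most 1, so the same holds for
  the entries of a state; the bound is the number of entries.\<close>

lemma bounded_states: "\<exists>M. \<forall>\<rho> :: complex^'n^'n. state \<rho> \<longrightarrow> norm \<rho> \<le> M"
proof (intro exI allI impI)
  fix \<rho> :: "complex^'n^'n" assume \<rho>: "state \<rho>"
  hence "hermitian_mat \<rho>" by (simp add: state_def pos_semidef_def)
  then obtain U p where U: "unitary_mat U" and \<rho>_eq: "\<rho> = U ** real_diag p ** mat_adjoint U"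
    by (rule hermitian_spectral)
  have p0: "p i \<ge> 0" for i
    using pos_semidef_unitary_conj_nonneg[OF U] \<rho> by (simp add: \<rho>_eq state_def)
  have p1: "(\<Sum>i\<in>UNIV. p i) = 1"
    using \<rho> U by (simp add: \<rho>_eq state_def trace_unitary_conj trace_real_diag del: of_real_sum)
  have U1: "cmod (U $ i $ j) \<le> 1" for i j
  proof -
    have "(cmod (U $ i $ j))\<^sup>2 \<le> (\<Sum>j\<in>UNIV. (cmod (U $ i $ j))\<^sup>2)"
      by (rule member_le_sum) auto
    hence "(cmod (U $ i $ j))\<^sup>2 \<le> 1\<^sup>2" using unitary_mat_row_sum[OF U] by simp
    thus ?thesis by (rule power2_le_imp_le) simp
  qed
  have entry: "cmod (\<rho> $ i $ j) \<le> 1" for i j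
  proof -
    have "cmod (\<rho> $ i $ j) \<le> (\<Sum>k\<in>UNIV. cmod (U $ i $ k) * cmod (U $ j $ k) * p k)"
      unfolding \<rho>_eq unitary_conj_real_diag_nth
      by (rule order_trans[OF norm_sum]) (simp add: norm_mult p0)
    also have "\<dots> \<le> (\<Sum>k\<in>UNIV. 1 * 1 * p k)"
      by (intro sum_mono mult_mono U1 p0) (auto simp: p0)
    finally show ?thesis using p1 by simp
  qed
  have "norm \<rho> \<le> (\<Sum>i\<in>UNIV. norm (\<rho> $ i))"
    unfolding norm_vec_def[of \<rho>] by (rule L2_set_le_sum) simp
  also have "\<dots> \<le> (\<Sum>i\<in>(UNIV :: 'n set). \<Sum>j\<in>(UNIV :: 'n set). 1)"
  proof (rule sum_mono)
    fix i
    have "norm (\<rho> $ i) \<le> (\<Sum>j\<in>UNIV. cmod (\<rho> $ i $ j))"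
      unfolding norm_vec_def[of "\<rho> $ i"] by (rule L2_set_le_sum) simp
    also have "\<dots> \<le> (\<Sum>j\<in>(UNIV :: 'n set). 1)" by (intro sum_mono entry)
    finally show "norm (\<rho> $ i) \<le> (\<Sum>j\<in>(UNIV :: 'n set). 1)" .
  qed
  finally show "norm \<rho> \<le> (\<Sum>i\<in>(UNIV :: 'n set). \<Sum>j\<in>(UNIV :: 'n set). 1)" .
qed

text \<open>Made for frozen exponents: only at \<open>a\<close> must the state be the Gibbs state of
  its exponent. The conserved expectation values are what turns the total change into increments of
  \<open>P\<close>, paired once with the trial state \<open>gibbs (P b)\<close> and once with the
  actual states.\<close>

lemma entropy_increase_le:
  fixes w P :: "nat \<Rightarrow> complex^'n^'n"
  assumes ab: "a \<le> b" and herm: "\<And>m. m \<in> {a..b} \<Longrightarrow> hermitian_mat (P m)"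
    and state: "state (w b)" and start: "w a = gibbs (P a)"
    and cons: "\<And>m. m \<in> {a..<b} \<Longrightarrow>
      Re (trace (w (Suc m) ** P (Suc m))) = Re (trace (w m ** P (Suc m)))"
  shows "vn_entropy (w b) - vn_entropy (w a)
    \<le> (\<Sum>m=a..<b. Re (trace ((gibbs (P b) - w m) ** (P (Suc m) - P m))))"
proof -
  interpret tr: bounded_bilinear "\<lambda>A B :: complex^'n^'n. Re (trace (A ** B))"
    by (rule bounded_bilinear_Re_trace_mult)
  define lnZ where "lnZ m = ln (Re (trace (mat_exp (P m))))" for m
  let ?g = "gibbs (P b)"
  have Pa: "hermitian_mat (P a)" and Pb: "hermitian_mat (P b)" using herm ab by auto
  have "vn_entropy (w b) \<le> lnZ b - Re (trace (w b ** P b))"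
    using gibbs_variational[OF state Pb] by (simp add: lnZ_def)
  moreover have "vn_entropy (w a) = lnZ a - Re (trace (w a ** P a))"
    using vn_entropy_gibbs[OF Pa] by (simp add: start lnZ_def)
  \<comment> \<open>Convexity of ln tr exp, whose gradient at \<open>P b\<close> is
    \<open>gibbs (P b)\<close>: that state is tested in the variational principle for
    \<open>P a\<close>.\<close>
  moreover have "lnZ b - lnZ a \<le> Re (trace (?g ** (P b - P a)))"
    using vn_entropy_gibbs[OF Pb] gibbs_variational[OF state_gibbs[OF Pb] Pa]
    by (simp add: lnZ_def tr.diff_right)
  moreover have "Re (trace (?g ** (P b - P a))) = (\<Sum>m=a..<b. Re (trace (?g ** (P (Suc m) - P m))))"
    using ab by (simp add: sum_Suc_diff' flip: tr.sum_right)
  \<comment> \<open>In each increment of tr(w P) conservation cancels the change of state at fixed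
    observable; the change of observable at fixed state remains.\<close>
  moreover have "Re (trace (w b ** P b)) - Re (trace (w a ** P a))
      = (\<Sum>m=a..<b. Re (trace (w m ** (P (Suc m) - P m))))"
  proof -
    have "Re (trace (w b ** P b)) - Re (trace (w a ** P a))
        = (\<Sum>m=a..<b. Re (trace (w (Suc m) ** P (Suc m))) - Re (trace (w m ** P m)))"
      using ab by (simp add: sum_Suc_diff'[of a b "\<lambda>m. Re (trace (w m ** P m))"])
    thus ?thesis using cons by (simp add: tr.diff_right)
  qed
  ultimately show ?thesis
    by (simp add: tr.diff_left sum_subtractf)
qed

section \<open>Grid points, Lipschitz extension and step functions\<close>

lemma grid_point_tendsto:
  "u \<in> {0..1} \<Longrightarrow> (\<lambda>N. real (nat \<lfloor>u * real N\<rfloor>) / real N) \<longlonglongrightarrow> u"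
proof (rule real_tendsto_sandwich[where f = "\<lambda>N. u - 1 / real N" and h = "\<lambda>N. u"])
  assume u: "u \<in> {0..1}"
  have "u - 1 / real N \<le> real (nat \<lfloor>u * real N\<rfloor>) / real N \<and> real (nat \<lfloor>u * real N\<rfloor>) / real N \<le> u"
    if "N \<ge> 1" for N
  proof -
    have "real (nat \<lfloor>u * real N\<rfloor>) = of_int \<lfloor>u * real N\<rfloor>" using u by simp
    moreover have "u * real N - 1 \<le> of_int \<lfloor>u * real N\<rfloor>" "of_int \<lfloor>u * real N\<rfloor> \<le> u * real N"
      by linarith+
    ultimately have "(u * real N - 1) / real N \<le> real (nat \<lfloor>u * real N\<rfloor>) / real N"
      "real (nat \<lfloor>u * real N\<rfloor>) / real N \<le> u * real N / real N"
      by (intro divide_right_mono; simp)+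
    thus ?thesis using that by (simp add: diff_divide_distrib)
  qed
  thus "\<forall>\<^sub>F N in sequentially. u - 1 / real N \<le> real (nat \<lfloor>u * real N\<rfloor>) / real N"
    "\<forall>\<^sub>F N in sequentially. real (nat \<lfloor>u * real N\<rfloor>) / real N \<le> u"
    by (auto intro: eventually_sequentiallyI[of 1])
  show "(\<lambda>N. u - 1 / real N) \<longlonglongrightarrow> u"
    using tendsto_diff[OF tendsto_const[of u] lim_1_over_n] by simp
qed auto

lemma grid_index_le: "u \<in> {0..1} \<Longrightarrow> nat \<lfloor>u * real N\<rfloor> \<le> N"
  by (simp add: nat_le_iff floor_le_iff) (smt (verit) mult_left_le_one_le of_nat_0_le_iff)

text \<open>The condition says nothing about irrational points, so \<open>F\<close> itself may be
  discontinuous. Two fractions are compared over a common denominator, which makes \<open>F\<close>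
  Lipschitz on the rationals of the unit interval; \<open>G\<close> extends it to their closure with
  the same constant.\<close>

lemma steps_of_order_inverse_lipschitz:
  fixes F :: "real \<Rightarrow> complex^'n^'n"
  assumes "steps_of_order_inverse F"
  obtains C G where "C-lipschitz_on {0..1} G"
    "\<And>N m. N \<ge> 1 \<Longrightarrow> m \<le> N \<Longrightarrow> G (real m / real N) = F (real m / real N)"
proof -
  obtain C where C: "\<And>N m. N \<ge> 1 \<Longrightarrow> m < N \<Longrightarrow>
      norm (F (real (m + 1) / real N) - F (real m / real N)) \<le> C / real N"
    using assms unfolding steps_of_order_inverse_def by blast
  have C0: "C \<ge> 0" using C[of 1 0] norm_ge_zero by (smt (verit) div_by_1 le_refl less_one of_nat_1)
  have grid: "norm (F (real m' / real N) - F (real m / real N)) \<le> C * (real m' / real N - real m / real N)"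
    if N: "N \<ge> 1" and "m \<le> m'" "m' \<le> N" for N m m'
    using that(2,3)
  proof (induction m' rule: dec_induct)
    case base
    then show ?case by simp
  next
    case (step i)
    have "norm (F (real (Suc i) / real N) - F (real m / real N))
        \<le> norm (F (real (i + 1) / real N) - F (real i / real N)) + norm (F (real i / real N) - F (real m / real N))"
      using norm_triangle_ineq[of "F (real (Suc i) / real N) - F (real i / real N)" "F (real i / real N) - F (real m / real N)"]
      by simp
    also have "\<dots> \<le> C / real N + C * (real i / real N - real m / real N)"
      using step C[of N i] N by (intro add_mono) auto
    also have "\<dots> = C * (real (Suc i) / real N - real m / real N)"
      by (simp add: add_divide_distrib distrib_left right_diff_distrib)
    finally show ?case .
  qed
  define R where "R = {real m / real N | m N. N \<ge> 1 \<and> m \<le> N}"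
  have rat: "dist (F x) (F y) \<le> C * dist x y" if "x \<in> R" "y \<in> R" for x y
  proof -
    obtain m N m' N' where N: "x = real m / real N" "N \<ge> 1" "m \<le> N"
      "y = real m' / real N'" "N' \<ge> 1" "m' \<le> N'" using \<open>x \<in> R\<close> \<open>y \<in> R\<close> by (auto simp: R_def)
    define a b M where "a = m * N'" and "b = m' * N" and "M = N * N'"
    have "x = real a / real M" "y = real b / real M" "M \<ge> 1" "a \<le> M" "b \<le> M"
      using N by (auto simp: a_def b_def M_def mult.commute intro: mult_le_mono)
    thus ?thesis
      using grid[of M a b] grid[of M b a]
      by (cases "a \<le> b") (auto simp: dist_norm norm_minus_commute divide_right_mono)
  qed
  hence lip: "C-lipschitz_on R F" using C0 by (intro lipschitz_onI) auto
  obtain G where G: "uniformly_continuous_on (closure R) G" "\<And>x. x \<in> R \<Longrightarrow> F x = G x"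
    using uniformly_continuous_on_extension_on_closure[OF lipschitz_on_uniformly_continuous[OF lip]] by metis
  have "C-lipschitz_on R G" using lip G(2) by (simp add: lipschitz_on_def)
  hence lipG: "C-lipschitz_on (closure R) G"
    using G(1) uniformly_continuous_imp_continuous lipschitz_on_closure by blast
  have "u \<in> closure R" if u: "u \<in> {0..1}" for u
    unfolding closure_sequential
  proof (intro exI[of _ "\<lambda>n. real (nat \<lfloor>u * real (Suc n)\<rfloor>) / real (Suc n)"] conjI allI)
    show "real (nat \<lfloor>u * real (Suc n)\<rfloor>) / real (Suc n) \<in> R" for n
      unfolding R_def using grid_index_le[OF u, of "Suc n"] by fastforce
    show "(\<lambda>n. real (nat \<lfloor>u * real (Suc n)\<rfloor>) / real (Suc n)) \<longlonglongrightarrow> u"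
      by (rule LIMSEQ_Suc[OF grid_point_tendsto[OF u]])
  qed
  hence "C-lipschitz_on {0..1} G" using lipG by (rule_tac lipschitz_on_subset) auto
  moreover have "G (real m / real N) = F (real m / real N)" if "N \<ge> 1" "m \<le> N" for N m
    using G(2) that unfolding R_def by fastforce
  ultimately show ?thesis using that by blast
qed

text \<open>Turns a sum over quench steps into an integral over the rescaled time \<open>u\<close>,
  to which limit theorems for integrals apply.\<close>

lemma has_integral_step_function:
  fixes h :: "nat \<Rightarrow> real"
  assumes "N \<ge> 1" "a \<le> b"
  shows "((\<lambda>u. h (nat \<lfloor>u * real N\<rfloor>)) has_integral (\<Sum>m=a..<b. h m) / real N) {real a / real N..real b / real N}"
  using assms(2)
proof (induction b rule: dec_induct)
  case base
  then show ?case by (simp add: has_integral_refl)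
next
  case (step b)
  have "((\<lambda>u. h (nat \<lfloor>u * real N\<rfloor>)) has_integral h b / real N) {real b / real N..real (Suc b) / real N}"
  \<comment> \<open>At the right end point the floor has already jumped to \<open>Suc b\<close>; a
    single point does not affect the integral.\<close>
  proof (rule has_integral_spike_finite[of "{real (Suc b) / real N}" _ _ "\<lambda>u. h b"])
    fix u assume "u \<in> {real b / real N..real (Suc b) / real N} - {real (Suc b) / real N}"
    hence "real b \<le> u * real N" "u * real N < real b + 1"
      using assms(1) by (auto simp: field_simps)
    hence "\<lfloor>u * real N\<rfloor> = int b" by (simp add: floor_eq_iff)
    thus "h (nat \<lfloor>u * real N\<rfloor>) = h b" by simp
  next
    show "((\<lambda>u. h b) has_integral h b / real N) {real b / real N..real (Suc b) / real N}"
      using has_integral_const_real[of "h b" "real b / real N" "real (Suc b) / real N"] assms(1)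
      by (simp add: divide_simps diff_divide_distrib[symmetric])
  qed simp
  from has_integral_combine[OF _ _ step.IH this] show ?case
    using step.hyps assms(1) by (simp add: divide_right_mono add_divide_distrib)
qed

section \<open>Quench processes\<close>

lemma gge_quench_process_gibbs:
  assumes "gge_quench_process H q Q \<rho> N w l" "m \<le> N"
  shows "w m = gibbs (\<Sum>j=1..q. l m j *\<^sub>R Q j (real m / real N))"
  using assms by (simp add: gge_quench_process_def gge_state_eq_gibbs)

lemma gge_quench_process_state:
  assumes "gge_quench_process H q Q \<rho> N w l" "m \<le> N"
  shows "state (w m)"
proof (cases "m = 0")
  case False
  then have "m \<in> {1..N}" using assms(2) by simp
  then show ?thesis using assms(1) unfolding gge_quench_process_def gge_equilibrium_def by blast
next
  case True
  then show ?thesis using assms(1) unfolding gge_quench_process_def gge_equilibrium_def by blast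
qed

lemma gge_quench_process_step:
  assumes "gge_quench_process H q Q \<rho> N w l" "m < N"
  shows "gge_equilibrium (H (real (Suc m) / real N)) q (\<lambda>i. Q i (real (Suc m) / real N)) (w m) (w (Suc m))"
proof -
  have "Suc m \<in> {1..N}" using assms(2) by simp
  then show ?thesis using assms(1) unfolding gge_quench_process_def by (metis diff_Suc_1)
qed

lemma gge_quench_process_entropy_mono:
  assumes "gge_quench_process H q Q \<rho> N w l" "m \<le> m'" "m' \<le> N"
  shows "vn_entropy (w m) \<le> vn_entropy (w m')"
  using assms(2,3)
proof (induction m' rule: dec_induct)
  case (step i)
  have "vn_entropy (w i) \<le> vn_entropy (w (Suc i))"
    using gge_quench_process_step[OF assms(1), of i] gge_quench_process_state[OF assms(1), of i] step
    by (simp add: gge_equilibrium_def same_expectations_def)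
  with step show ?case by simp
qed simp

text \<open>All exponents carry the multipliers of step \<open>a\<close>, so their increments stem
  from the \<open>Q j\<close> alone and are of order 1/N. The factor 1/N stays beside the sum over
  \<open>m\<close>, since the two together are the integral of a step function.\<close>

lemma gge_quench_process_entropy_increase_le:
  fixes Q :: "nat \<Rightarrow> real \<Rightarrow> complex^'n^'n"
  assumes proc: "gge_quench_process H q Q \<rho> N w l"
    and herm: "\<And>j m. j \<in> {1..q} \<Longrightarrow> m \<le> N \<Longrightarrow> hermitian_mat (Q j (real m / real N))"
    and lip: "\<And>j m. j \<in> {1..q} \<Longrightarrow> m < N \<Longrightarrow>
      norm (Q j (real (Suc m) / real N) - Q j (real m / real N)) \<le> C j / real N"
    and K: "\<And>A B :: complex^'n^'n. \<bar>Re (trace (A ** B))\<bar> \<le> norm A * norm B * K" "K \<ge> 0"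
    and ab: "a \<le> b" "b \<le> N"
  shows "vn_entropy (w b) - vn_entropy (w a) \<le> K * (\<Sum>j=1..q. \<bar>l a j\<bar> * C j) *
    ((\<Sum>m=a..<b. norm (gibbs (\<Sum>j=1..q. l a j *\<^sub>R Q j (real b / real N)) - w m)) / real N)"
proof -
  define P where "P m = (\<Sum>j=1..q. l a j *\<^sub>R Q j (real m / real N))" for m
  have "vn_entropy (w b) - vn_entropy (w a)
      \<le> (\<Sum>m=a..<b. Re (trace ((gibbs (P b) - w m) ** (P (Suc m) - P m))))"
  proof (rule entropy_increase_le[OF ab(1)])
    show "hermitian_mat (P m)" if "m \<in> {a..b}" for m
      using that ab herm unfolding P_def by (intro hermitian_mat_sum_scaleR) auto
    show "state (w b)" by (rule gge_quench_process_state[OF proc ab(2)])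
    show "w a = gibbs (P a)"
      unfolding P_def by (rule gge_quench_process_gibbs[OF proc]) (use ab in simp)
    fix m assume m: "m \<in> {a..<b}"
    have *: "Re (trace (A ** P (Suc m))) = (\<Sum>j=1..q. l a j * Re (trace (A ** Q j (real (Suc m) / real N))))" for A
      unfolding P_def bounded_bilinear.sum_right[OF bounded_bilinear_Re_trace_mult]
        bounded_bilinear.scaleR_right[OF bounded_bilinear_Re_trace_mult] by simp
    \<comment> \<open>The equilibration to step \<open>Suc m\<close> preserves each
      \<open>Q j\<close> at the new grid point, hence also their combination
      \<open>P (Suc m)\<close>, whatever its coefficients.\<close>
    show "Re (trace (w (Suc m) ** P (Suc m))) = Re (trace (w m ** P (Suc m)))"
      unfolding * using gge_quench_process_step[OF proc, of m] m ab
      by (intro sum.cong) (auto simp: gge_equilibrium_def same_expectations_def)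
  qed
  also have "\<dots> \<le> (\<Sum>m=a..<b. norm (gibbs (P b) - w m) * ((\<Sum>j=1..q. \<bar>l a j\<bar> * C j) / real N) * K)"
  proof (rule sum_mono)
    fix m assume m: "m \<in> {a..<b}"
    have "norm (P (Suc m) - P m) \<le> (\<Sum>j=1..q. \<bar>l a j\<bar> * (C j / real N))"
      unfolding P_def sum_subtractf[symmetric] scaleR_diff_right[symmetric]
    proof (rule sum_norm_le)
      fix j assume "j \<in> {1..q}"
      thus "norm (l a j *\<^sub>R (Q j (real (Suc m) / real N) - Q j (real m / real N)))
          \<le> \<bar>l a j\<bar> * (C j / real N)"
        unfolding norm_scaleR using m ab by (intro mult_left_mono lip) auto
    qed
    also have "\<dots> = (\<Sum>j=1..q. \<bar>l a j\<bar> * C j) / real N"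
      by (simp add: sum_divide_distrib)
    finally have "norm (gibbs (P b) - w m) * norm (P (Suc m) - P m) * K
        \<le> norm (gibbs (P b) - w m) * ((\<Sum>j=1..q. \<bar>l a j\<bar> * C j) / real N) * K"
      using K(2) by (intro mult_right_mono mult_left_mono) auto
    thus "Re (trace ((gibbs (P b) - w m) ** (P (Suc m) - P m)))
        \<le> norm (gibbs (P b) - w m) * ((\<Sum>j=1..q. \<bar>l a j\<bar> * C j) / real N) * K"
      using K(1)[of "gibbs (P b) - w m" "P (Suc m) - P m"] by linarith
  qed
  also have "\<dots> = K * (\<Sum>j=1..q. \<bar>l a j\<bar> * C j) * ((\<Sum>m=a..<b. norm (gibbs (P b) - w m)) / real N)"
    unfolding sum_distrib_right[symmetric] by simp
  finally show ?thesis by (simp add: P_def)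
qed

section \<open>The quasi-static limit\<close>

lemma smooth_on_unit_continuous_on: "smooth_on_unit f \<Longrightarrow> continuous_on {0..1} f"
  unfolding smooth_on_unit_def by (metis DERIV_continuous_on)

theorem mainTheorem2:
  fixes H :: "real \<Rightarrow> complex^'n^'n"
    and q :: nat
    and Q :: "nat \<Rightarrow> real \<Rightarrow> complex^'n^'n"
    and \<rho>\<^sub>0 :: "complex^'n^'n"
    and \<omega>\<^sub>N :: "nat \<Rightarrow> nat \<Rightarrow> complex^'n^'n"
    and l\<^sub>N :: "nat \<Rightarrow> nat \<Rightarrow> nat \<Rightarrow> real"
    and \<omega> :: "real \<Rightarrow> complex^'n^'n"
    and l :: "nat \<Rightarrow> real \<Rightarrow> real"
  assumes "\<And>u. u \<in> {0..1} \<Longrightarrow> hermitian_mat (H u)"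
    and "\<And>u i. u \<in> {0..1} \<Longrightarrow> i \<in> {1..q} \<Longrightarrow> conserved_quantity (H u) (Q i u)"
    and "steps_of_order_inverse H"
    and "\<And>i. i \<in> {1..q} \<Longrightarrow> steps_of_order_inverse (Q i)"
    and "state \<rho>\<^sub>0"
    and "\<And>N. N \<ge> 1 \<Longrightarrow> gge_quench_process H q Q \<rho>\<^sub>0 N (\<omega>\<^sub>N N) (l\<^sub>N N)"
    and "quasi_static_limit \<omega>\<^sub>N \<omega>"
    and "\<And>j. j \<in> {1..q} \<Longrightarrow> quasi_static_limit (\<lambda>N m. l\<^sub>N N m j) (l j)"
    and "\<And>j. j \<in> {1..q} \<Longrightarrow> smooth_on_unit (l j)"
  shows "\<forall>u\<in>{0..1}. vn_entropy (\<omega> u) = vn_entropy (\<omega> 0)"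
proof -
  note proc = assms(6)
  have "\<exists>G C. C-lipschitz_on {0..1} G \<and> (\<forall>N m. N \<ge> 1 \<longrightarrow> m \<le> N \<longrightarrow> G (real m / real N) = Q j (real m / real N))"
    if "j \<in> {1..q}" for j
    using steps_of_order_inverse_lipschitz[OF assms(4)[OF that]] by metis
  then obtain Qt C where lip: "\<And>j. j \<in> {1..q} \<Longrightarrow> (C j)-lipschitz_on {0..1} (Qt j)"
    and Qt: "\<And>j N m. j \<in> {1..q} \<Longrightarrow> N \<ge> 1 \<Longrightarrow> m \<le> N \<Longrightarrow> Qt j (real m / real N) = Q j (real m / real N)"
    by metis
  have C0: "C j \<ge> 0" if "j \<in> {1..q}" for j using lip[OF that] by (rule lipschitz_on_nonneg)
  have contQ: "continuous_on {0..1} (Qt j)" if "j \<in> {1..q}" for j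
    using lip[OF that] by (rule lipschitz_on_continuous_on)
  have contl: "continuous_on {0..1} (l j)" if "j \<in> {1..q}" for j
    using assms(9)[OF that] by (rule smooth_on_unit_continuous_on)
  define idx where "idx N u = nat \<lfloor>u * real N\<rfloor>" for N u
  have idx_le: "idx N u \<le> N" if "u \<in> {0..1}" for N u
    using grid_index_le[OF that] by (simp add: idx_def)
  have grid01: "real m / real N \<in> {0..1}" if "m \<le> N" for m N
    using that by (cases "N = 0") auto
  have Qt_lim: "(\<lambda>N. Qt j (real (idx N u) / real N)) \<longlonglongrightarrow> Qt j u" if "j \<in> {1..q}" "u \<in> {0..1}" for j u
    unfolding idx_def using that grid_index_le grid01
    by (intro continuous_on_tendsto_compose[OF contQ grid_point_tendsto] always_eventually) blast+
  have hermQ: "hermitian_mat (Q j (real m / real N))" if "j \<in> {1..q}" "m \<le> N" for j m N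
    using assms(2)[OF grid01[OF that(2)] that(1)] by (simp add: conserved_quantity_def)
  \<comment> \<open>Off the rational points \<open>Qt\<close> is known only as an extension, so
    hermiticity is inherited along grid points. The shift by \<open>LIMSEQ_Suc\<close> keeps to
    \<open>N \<ge> 1\<close>, as the agreement with \<open>Q\<close> demands.\<close>
  have hermQt: "hermitian_mat (Qt j u)" if "j \<in> {1..q}" "u \<in> {0..1}" for j u
  proof (rule hermitian_mat_LIMSEQ[OF LIMSEQ_Suc[OF Qt_lim[OF that]]])
    show "hermitian_mat (Qt j (real (idx (Suc n) u) / real (Suc n)))" for n
      unfolding Qt[OF that(1) Suc_le_mono[THEN iffD2, OF le0, folded One_nat_def] idx_le[OF that(2)]]
      by (rule hermQ[OF that(1) idx_le[OF that(2)]])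
  qed
  define P where "P la u = (\<Sum>j=1..q. la j *\<^sub>R Qt j u)" for la u
  have hermP: "hermitian_mat (P la u)" if "u \<in> {0..1}" for la u
    unfolding P_def using hermQt that by (intro hermitian_mat_sum_scaleR) auto
  have P_Q: "P la (real m / real N) = (\<Sum>j=1..q. la j *\<^sub>R Q j (real m / real N))"
    if "N \<ge> 1" "m \<le> N" for la m N
    unfolding P_def using Qt that by (intro sum.cong) auto
  have \<omega>\<^sub>N: "\<omega>\<^sub>N N m = gibbs (P (l\<^sub>N N m) (real m / real N))" if "N \<ge> 1" "m \<le> N" for N m
    using gge_quench_process_gibbs[OF proc] that by (simp add: P_Q)
  have l_lim: "(\<lambda>N. l\<^sub>N N (idx N u) j) \<longlonglongrightarrow> l j u" if "j \<in> {1..q}" "u \<in> {0..1}" for j u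
    using assms(8)[OF that(1)] that(2) by (simp add: quasi_static_limit_def idx_def)
  have \<omega>_lim: "(\<lambda>N. \<omega>\<^sub>N N (idx N u)) \<longlonglongrightarrow> \<omega> u" if "u \<in> {0..1}" for u
    using assms(7) that by (simp add: quasi_static_limit_def idx_def)
  have P_lim: "(\<lambda>N. P (l\<^sub>N N (idx N u)) (real (idx N u) / real N)) \<longlonglongrightarrow> P (\<lambda>j. l j u) u" if "u \<in> {0..1}" for u
    unfolding P_def by (intro tendsto_sum tendsto_scaleR l_lim Qt_lim that) 
  have gibbs_lim: "(\<lambda>n. gibbs (X n)) \<longlonglongrightarrow> gibbs A" "(\<lambda>n. vn_entropy (gibbs (X n))) \<longlonglongrightarrow> vn_entropy (gibbs A)"
    if "X \<longlonglongrightarrow> A" "hermitian_mat A" "\<And>n. hermitian_mat (X n)" for X and A :: "complex^'n^'n"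
    using that continuous_on_tendsto_compose[OF continuous_on_gibbs that(1)]
      continuous_on_tendsto_compose[OF continuous_on_vn_entropy_gibbs that(1)] by auto
  have \<omega>_lim': "(\<lambda>N. gibbs (P (l\<^sub>N N (idx N u)) (real (idx N u) / real N))) \<longlonglongrightarrow> gibbs (P (\<lambda>j. l j u) u)"
    and S_lim': "(\<lambda>N. vn_entropy (gibbs (P (l\<^sub>N N (idx N u)) (real (idx N u) / real N))))
      \<longlonglongrightarrow> vn_entropy (gibbs (P (\<lambda>j. l j u) u))" if "u \<in> {0..1}" for u
    by (intro gibbs_lim P_lim hermP that grid01 idx_le)+
  \<comment> \<open>The exponent contains \<open>Qt\<close>, since \<open>Q\<close> is uncontrolled
    at irrational \<open>u\<close>. The index is shifted because the process is given for
    \<open>N \<ge> 1\<close>.\<close>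
  have \<omega>: "\<omega> u = gibbs (P (\<lambda>j. l j u) u)" if u: "u \<in> {0..1}" for u
  proof (rule LIMSEQ_unique[OF LIMSEQ_Suc[OF \<omega>_lim[OF u]]])
    show "(\<lambda>N. \<omega>\<^sub>N (Suc N) (idx (Suc N) u)) \<longlonglongrightarrow> gibbs (P (\<lambda>j. l j u) u)"
      using LIMSEQ_Suc[OF \<omega>_lim'[OF u]] idx_le[OF u] by (simp add: \<omega>\<^sub>N)
  qed
  have S_lim: "(\<lambda>N. vn_entropy (\<omega>\<^sub>N N (idx N u))) \<longlonglongrightarrow> vn_entropy (\<omega> u)" if u: "u \<in> {0..1}" for u
  proof (rule LIMSEQ_imp_Suc)
    show "(\<lambda>N. vn_entropy (\<omega>\<^sub>N (Suc N) (idx (Suc N) u))) \<longlonglongrightarrow> vn_entropy (\<omega> u)"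
      using LIMSEQ_Suc[OF S_lim'[OF u]] idx_le[OF u] by (simp add: \<omega>\<^sub>N \<omega>[OF u])
  qed
  have S_mono: "vn_entropy (\<omega> u) \<le> vn_entropy (\<omega> v)" if "u \<in> {0..1}" "v \<in> {0..1}" "u \<le> v" for u v
  proof (rule LIMSEQ_le[OF S_lim S_lim])
    show "\<exists>N0. \<forall>N\<ge>N0. vn_entropy (\<omega>\<^sub>N N (idx N u)) \<le> vn_entropy (\<omega>\<^sub>N N (idx N v))"
      using that idx_le
      by (intro exI[of _ 1] allI impI gge_quench_process_entropy_mono[OF proc])
        (auto simp: idx_def intro!: nat_mono floor_mono mult_right_mono)
  qed (use that in auto)
  obtain M where M: "\<And>\<rho> :: complex^'n^'n. state \<rho> \<Longrightarrow> norm \<rho> \<le> M"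
    using bounded_states by blast
  obtain K where K: "K > 0" "\<And>A B :: complex^'n^'n. \<bar>Re (trace (A ** B))\<bar> \<le> norm A * norm B * K"
    using bounded_bilinear.pos_bounded[OF bounded_bilinear_Re_trace_mult[where 'n = 'n]]
    unfolding real_norm_def by blast
  define G where "G = (\<lambda>(a, b). gibbs (P (\<lambda>j. l j a) b))"
  have "continuous_on ({0..1} \<times> {0..1}) (\<lambda>z. P (\<lambda>j. l j (fst z)) (snd z))"
    unfolding P_def
    by (intro continuous_intros continuous_on_compose2[OF contl] continuous_on_compose2[OF contQ]) auto
  hence "continuous_on ({0..1} \<times> {0..1}) G"
    unfolding G_def case_prod_unfold
    by (rule continuous_on_compose2[OF continuous_on_gibbs]) (auto intro: hermP)
  hence unif: "uniformly_continuous_on ({0..1} \<times> {0..1}) G"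
    by (intro compact_uniformly_continuous compact_Times compact_Icc)
  have "\<exists>L. \<forall>u\<in>{0..1}. (\<Sum>j=1..q. \<bar>l j u\<bar> * C j) \<le> L"
  proof -
    have "continuous_on {0..1} (\<lambda>u. \<Sum>j=1..q. \<bar>l j u\<bar> * C j)"
      by (intro continuous_intros contl) auto
    thus ?thesis
      using continuous_attains_sup[of "{0..1::real}" "\<lambda>u. \<Sum>j=1..q. \<bar>l j u\<bar> * C j"] by auto
  qed
  then obtain L where L: "\<And>u. u \<in> {0..1} \<Longrightarrow> (\<Sum>j=1..q. \<bar>l j u\<bar> * C j) \<le> L" by blast
  have L0: "L \<ge> 0"
    using L[of 0] sum_nonneg[of "{1..q}" "\<lambda>j. \<bar>l j 0\<bar> * C j"] C0 by force
  have step: "vn_entropy (\<omega> (real (Suc i) / real k)) - vn_entropy (\<omega> (real i / real k)) \<le> K * L * (\<epsilon> / real k)"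
    if i: "i < k" and \<epsilon>: "\<epsilon> \<ge> 0"
      and G: "\<And>u. real i / real k \<le> u \<Longrightarrow> u \<le> real (Suc i) / real k \<Longrightarrow>
        norm (G (real i / real k, real (Suc i) / real k) - G (u, u)) \<le> \<epsilon>"
    for i k \<epsilon>
  proof -
    define a where "a = real i / real k"
    define b where "b = real (Suc i) / real k"
    have k: "k \<ge> 1" using i by simp
    have a01: "a \<in> {0..1}" and b01: "b \<in> {0..1}" and ab: "a \<le> b" and ba: "b - a = 1 / real k"
      unfolding a_def b_def using grid01[of i k] grid01[of "Suc i" k] i
      by (auto simp: field_simps)
    define N where "N n = k * Suc n" for n
    have N1: "N n \<ge> 1" for n using k by (simp add: N_def)
    have idxa: "idx (N n) a = i * Suc n" and idxb: "idx (N n) b = Suc i * Suc n" for n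
    proof -
      have "a * real (N n) = real (i * Suc n)" "b * real (N n) = real (Suc i * Suc n)"
        unfolding a_def b_def N_def of_nat_mult using k by simp_all
      thus "idx (N n) a = i * Suc n" "idx (N n) b = Suc i * Suc n"
        unfolding idx_def by (metis floor_of_nat nat_int)+
    qed
    have rata: "real (i * Suc n) / real (N n) = a" and ratb: "real (Suc i * Suc n) / real (N n) = b" for n
      unfolding a_def b_def N_def of_nat_mult using k by (simp_all del: of_nat_Suc)
    have N_sub: "strict_mono N" unfolding N_def using k by (intro strict_monoI) simp
    define la where "la n = l\<^sub>N (N n) (i * Suc n)" for n
    have la: "(\<lambda>n. la n j) \<longlonglongrightarrow> l j a" if "j \<in> {1..q}" for j
      using LIMSEQ_subseq_LIMSEQ[OF l_lim[OF that a01] N_sub]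
      by (simp add: o_def idxa la_def)
    have gb: "(\<lambda>n. gibbs (P (la n) b)) \<longlonglongrightarrow> G (a, b)"
      unfolding G_def case_prod_conv
    proof (rule gibbs_lim(1))
      show "(\<lambda>n. P (la n) b) \<longlonglongrightarrow> P (\<lambda>j. l j a) b"
        unfolding P_def by (intro tendsto_sum tendsto_scaleR la tendsto_const)
    qed (intro hermP b01)+
    define F where "F n u = norm (gibbs (P (la n) b) - \<omega>\<^sub>N (N n) (idx (N n) u))" for n u
    have F_int: "(F n has_integral
        (\<Sum>m=i * Suc n..<Suc i * Suc n. norm (gibbs (P (la n) b) - \<omega>\<^sub>N (N n) m)) / real (N n)) {a..b}" for n
      using has_integral_step_function[OF N1, of "i * Suc n" "Suc i * Suc n"
          "\<lambda>m. norm (gibbs (P (la n) b) - \<omega>\<^sub>N (N n) m)" n]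
      unfolding F_def[abs_def] idx_def rata ratb by simp
    have bound: "vn_entropy (\<omega>\<^sub>N (N n) (idx (N n) b)) - vn_entropy (\<omega>\<^sub>N (N n) (idx (N n) a))
        \<le> K * (\<Sum>j=1..q. \<bar>la n j\<bar> * C j) * integral {a..b} (F n)" for n
    proof -
      have "vn_entropy (\<omega>\<^sub>N (N n) (Suc i * Suc n)) - vn_entropy (\<omega>\<^sub>N (N n) (i * Suc n))
          \<le> K * (\<Sum>j=1..q. \<bar>l\<^sub>N (N n) (i * Suc n) j\<bar> * C j) *
            ((\<Sum>m=i * Suc n..<Suc i * Suc n. norm (gibbs (\<Sum>j=1..q. l\<^sub>N (N n) (i * Suc n) j *\<^sub>R
              Q j (real (Suc i * Suc n) / real (N n))) - \<omega>\<^sub>N (N n) m)) / real (N n))"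
      proof (rule gge_quench_process_entropy_increase_le[OF proc[OF N1]])
        fix j m assume j: "j \<in> {1..q}" and m: "m < N n"
        have "dist (Qt j (real (Suc m) / real (N n))) (Qt j (real m / real (N n)))
            \<le> C j * dist (real (Suc m) / real (N n)) (real m / real (N n))"
          using m by (intro lipschitz_onD[OF lip[OF j]] grid01) auto
        also have "dist (real (Suc m) / real (N n)) (real m / real (N n)) = 1 / real (N n)"
          by (simp add: dist_real_def diff_divide_distrib[symmetric])
        finally show "norm (Q j (real (Suc m) / real (N n)) - Q j (real m / real (N n))) \<le> C j / real (N n)"
          using Qt[OF j N1, of "Suc m" n] Qt[OF j N1, of m n] m by (simp add: dist_norm)
      next
        show "i * Suc n \<le> Suc i * Suc n" "Suc i * Suc n \<le> N n"
          unfolding N_def using i by (intro mult_le_mono1; simp)+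
      next
        show "0 \<le> K" using K(1) by simp
      qed (fact hermQ, fact K(2))
      also have "(\<Sum>j=1..q. l\<^sub>N (N n) (i * Suc n) j *\<^sub>R Q j (real (Suc i * Suc n) / real (N n))) = P (la n) b"
        using P_Q[OF N1, of "Suc i * Suc n" n "la n"] idxb[of n] idx_le[OF b01, of "N n"]
        unfolding ratb la_def by simp
      finally show ?thesis
        using integral_unique[OF F_int[of n]] by (simp only: idxa idxb la_def)
    qed
    have F_lim: "(\<lambda>n. F n u) \<longlonglongrightarrow> norm (G (a, b) - G (u, u))" if "u \<in> {a..b}" for u
    proof -
      have u: "u \<in> {0..1}" using that a01 b01 by auto
      have "(\<lambda>n. \<omega>\<^sub>N (N n) (idx (N n) u)) \<longlonglongrightarrow> G (u, u)"
        using LIMSEQ_subseq_LIMSEQ[OF \<omega>_lim[OF u] N_sub] by (simp add: o_def G_def \<omega>[OF u])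
      thus ?thesis unfolding F_def by (intro tendsto_norm tendsto_diff gb)
    qed
    have F_le: "norm (F n u) \<le> M + M" if "u \<in> {a..b}" for n u
    proof -
      have u: "u \<in> {0..1}" using that a01 b01 by auto
      have "state (gibbs (P (la n) b))" by (intro state_gibbs hermP b01)
      moreover have "state (\<omega>\<^sub>N (N n) (idx (N n) u))"
        by (rule gge_quench_process_state[OF proc[OF N1] idx_le[OF u]])
      ultimately have "norm (gibbs (P (la n) b)) + norm (\<omega>\<^sub>N (N n) (idx (N n) u)) \<le> M + M"
        by (intro add_mono M)
      thus ?thesis unfolding F_def using norm_triangle_ineq4 order_trans by fastforce
    qed
    \<comment> \<open>The states converge only pointwise in \<open>u\<close>, with the constant
      \<open>M + M\<close> as majorant; integrability of the limit function comes from the same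
      theorem.\<close>
    have G_int: "(\<lambda>u. norm (G (a, b) - G (u, u))) integrable_on {a..b}"
      and F_int_lim: "(\<lambda>n. integral {a..b} (F n)) \<longlonglongrightarrow> integral {a..b} (\<lambda>u. norm (G (a, b) - G (u, u)))"
      using dominated_convergence[of F "{a..b}" "\<lambda>u. M + M", OF _ _ F_le F_lim] F_int
      by (auto simp: integrable_on_def[of "F _"])
    have "vn_entropy (\<omega> b) - vn_entropy (\<omega> a) \<le> K * (\<Sum>j=1..q. \<bar>l j a\<bar> * C j) *
        integral {a..b} (\<lambda>u. norm (G (a, b) - G (u, u)))"
    proof (rule LIMSEQ_le)
      show "(\<lambda>n. vn_entropy (\<omega>\<^sub>N (N n) (idx (N n) b)) - vn_entropy (\<omega>\<^sub>N (N n) (idx (N n) a)))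
          \<longlonglongrightarrow> vn_entropy (\<omega> b) - vn_entropy (\<omega> a)"
        using LIMSEQ_subseq_LIMSEQ[OF S_lim[OF b01] N_sub] LIMSEQ_subseq_LIMSEQ[OF S_lim[OF a01] N_sub]
        unfolding o_def by (rule tendsto_diff)
      show "(\<lambda>n. K * (\<Sum>j=1..q. \<bar>la n j\<bar> * C j) * integral {a..b} (F n))
          \<longlonglongrightarrow> K * (\<Sum>j=1..q. \<bar>l j a\<bar> * C j) * integral {a..b} (\<lambda>u. norm (G (a, b) - G (u, u)))"
        by (intro tendsto_intros F_int_lim la)
    qed (use bound in blast)
    also have "\<dots> \<le> K * L * (\<epsilon> / real k)"
    proof (rule mult_mono)
      have "integral {a..b} (\<lambda>u. norm (G (a, b) - G (u, u))) \<le> integral {a..b} (\<lambda>u. \<epsilon>)"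
        using G by (intro integral_le G_int) (auto simp: a_def b_def)
      also have "\<dots> = \<epsilon> / real k" using ab ba by simp
      finally show "integral {a..b} (\<lambda>u. norm (G (a, b) - G (u, u))) \<le> \<epsilon> / real k" .
      show "0 \<le> integral {a..b} (\<lambda>u. norm (G (a, b) - G (u, u)))"
        by (intro integral_nonneg G_int) auto
      show "K * (\<Sum>j=1..q. \<bar>l j a\<bar> * C j) \<le> K * L"
        using K(1) L[OF a01] by (intro mult_left_mono) auto
    qed (use K(1) L0 in auto)
    finally show ?thesis unfolding a_def b_def .
  qed
  have total: "vn_entropy (\<omega> 1) - vn_entropy (\<omega> 0) \<le> K * L * \<epsilon>" if \<epsilon>: "\<epsilon> > 0" for \<epsilon>
  proof -
    obtain d where d: "d > 0" "\<And>x y. x \<in> {0..1} \<times> {0..1} \<Longrightarrow> y \<in> {0..1} \<times> {0..1} \<Longrightarrow> dist y x < d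
        \<Longrightarrow> dist (G y) (G x) < \<epsilon>"
      using unif \<epsilon> unfolding uniformly_continuous_on_def by metis
    \<comment> \<open>For \<open>u\<close> in a cell the two coordinate distances to
      \<open>(u, u)\<close> add up to 1/k, so this \<open>k\<close> is large enough with room to
      spare.\<close>
    obtain k where k: "real k > 2 / d" using reals_Archimedean2 by blast
    have k0: "real k > 0" using k d(1) by (smt (verit) divide_pos_pos)
    have dk: "2 / real k < d" using k d(1) k0 by (simp add: field_simps)
    have "vn_entropy (\<omega> (real k / real k)) - vn_entropy (\<omega> (real 0 / real k))
        = (\<Sum>i<k. vn_entropy (\<omega> (real (Suc i) / real k)) - vn_entropy (\<omega> (real i / real k)))"
      by (rule sum_lessThan_telescope[of "\<lambda>i. vn_entropy (\<omega> (real i / real k))", symmetric])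
    also have "\<dots> \<le> (\<Sum>i<k. K * L * (\<epsilon> / real k))"
    proof (rule sum_mono, rule step)
      fix i u assume i: "i \<in> {..<k}" and u: "real i / real k \<le> u" "u \<le> real (Suc i) / real k"
      have 1: "real i / real k \<in> {0..1}" "real (Suc i) / real k \<in> {0..1}" using i by (auto intro!: grid01)
      have u01: "u \<in> {0..1}" using 1 u unfolding atLeastAtMost_iff by linarith
      have 2: "real (Suc i) / real k = real i / real k + 1 / real k"
        by (simp add: add_divide_distrib)
      have "dist (real i / real k, real (Suc i) / real k) (u, u)
          \<le> \<bar>real i / real k - u\<bar> + \<bar>real (Suc i) / real k - u\<bar>"
        unfolding dist_norm diff_Pair using norm_Pair_le real_norm_def by metis
      also have "\<dots> < d" using u dk 2 k0 by (simp add: abs_if)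
      finally show "norm (G (real i / real k, real (Suc i) / real k) - G (u, u)) \<le> \<epsilon>"
        using d(2)[of "(u, u)" "(real i / real k, real (Suc i) / real k)"] 1 u01
        by (auto simp: dist_norm less_imp_le)
    qed (use \<epsilon> in auto)
    also have "\<dots> = K * L * \<epsilon>" using k0 by simp
    finally show ?thesis using k0 by simp
  qed
  have "vn_entropy (\<omega> 1) - vn_entropy (\<omega> 0) \<le> 0"
  proof (rule field_le_epsilon)
    fix e :: real assume e: "e > 0"
    have KL: "K * L \<ge> 0" using K(1) L0 by simp
    \<comment> \<open>The summand 1 in the denominator covers the case
      \<open>K * L = 0\<close>.\<close>
    hence "vn_entropy (\<omega> 1) - vn_entropy (\<omega> 0) \<le> K * L * (e / (K * L + 1))"
      using e by (intro total divide_pos_pos) linarith+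
    also have "\<dots> \<le> (K * L + 1) * (e / (K * L + 1))"
      using KL e by (intro mult_right_mono divide_nonneg_nonneg) auto
    also have "\<dots> = e" using KL by simp
    finally show "vn_entropy (\<omega> 1) - vn_entropy (\<omega> 0) \<le> 0 + e" by simp
  qed
  \<comment> \<open>Monotonicity traps the entropy at \<open>u\<close> between its values at 0 and
    1, which now coincide.\<close>
  thus ?thesis using S_mono[of 0] S_mono[of _ 1] by force
qed

end
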